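(* Let $I=\{e^{it}:a\le t\le b\}$ with $0\le a<b\le 2\pi$, and let $k\in\{0,1,2,\dots\}\cup\{\infty\}$. Then each of the classes $U_2(I,k)$, $U_3(I,k)$, $U_4(I,k)$, $U_5(I,k)$ is a dense $G_\delta$ subset of $C^k(I)$.
   Context: $D=\{|z|<1\}$, $D(z_0,r)$ the open disk of center $z_0$, radius $r$. $C^k(I)$ is the space of $u:I\to\mathbb{C}$ such that $\theta\mapsto u(e^{i\theta})$ is $k$ times continuously differentiable on $[a,b]$ (one-sided at the endpoints), with seminorms $\sup_{\theta\in[a,b]}|\frac{d^l}{d\theta^l}u(e^{i\theta})|$, integers $0\le l\le k$. For $z_0\in I$, $r>0$ let $\Omega(z_0,r)=D(z_0,r)\cap\{|z|>1\}$, $P(z_0,r)=D(z_0,r)\cap D$. $U_2(I,z_0,k)$: the $u\in C^k(I)$ for which there exist no $r>0$ and no continuous $\lambda:I\cup\Omega(z_0,r)\to\mathbb{C}$ holomorphic on $\Omega(z_0,r)$ with $\lambda=u$ on $D(z_0,r)\cap I$. $U_3(I,z_0,k)$: the same with $P(z_0,r)$ instead of $\Omega(z_0,r)$. $U_4(I,z_0,k)=U_2(I,z_0,k)\cap U_3(I,z_0,k)$. $U_5(I,z_0,k)$: the $u\in C^k(I)$ for which there exist no $r>0$ and no holomorphic $F:D(z_0,r)\to\mathbb{C}$ with $F=u$ on $D(z_0,r)\cap I$. $U_j(I,k)=\bigcap_{z_0\in I}U_j(I,z_0,k)$, $j=2,3,4,5$. *)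

theory Defs
  imports "HOL-Analysis.Analysis" "HOL-Library.Extended_Nat"
begin

definition arc :: "real \<Rightarrow> real \<Rightarrow> complex set" where
  "arc a b = (\<lambda>t. cis t) ` {a..b}"

fun thderiv :: "real \<Rightarrow> real \<Rightarrow> nat \<Rightarrow> (complex \<Rightarrow> complex) \<Rightarrow> real \<Rightarrow> complex" where
  "thderiv a b 0 u = (\<lambda>t. u (cis t))"
| "thderiv a b (Suc l) u = (\<lambda>t. vector_derivative (thderiv a b l u) (at t within {a..b}))"

text \<open>C^k(I), k in {0,1,2,...} \<union> {infinity}. Functions I -> C are represented by
  functions complex => complex that vanish outside I (canonical representatives).\<close>
definition Ck :: "real \<Rightarrow> real \<Rightarrow> enat \<Rightarrow> (complex \<Rightarrow> complex) set" where
  "Ck a b k = {u. (\<forall>z. z \<notin> arc a b \<longrightarrow> u z = 0)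
      \<and> (\<forall>l. enat l \<le> k \<longrightarrow> continuous_on {a..b} (thderiv a b l u))
      \<and> (\<forall>l. enat l < k \<longrightarrow> (\<forall>t\<in>{a..b}.
             (thderiv a b l u has_vector_derivative thderiv a b (Suc l) u t) (at t within {a..b})))}"

definition seminormCk :: "real \<Rightarrow> real \<Rightarrow> nat \<Rightarrow> (complex \<Rightarrow> complex) \<Rightarrow> real" where
  "seminormCk a b l u = (SUP t\<in>{a..b}. norm (thderiv a b l u t))"

definition CkTop :: "real \<Rightarrow> real \<Rightarrow> enat \<Rightarrow> (complex \<Rightarrow> complex) topology" where
  "CkTop a b k = topology_generated_by
     {{v \<in> Ck a b k. seminormCk a b l (\<lambda>z. v z - u z) < e} | u l e.
        u \<in> Ck a b k \<and> enat l \<le> k \<and> e > 0}"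

definition Omega_out :: "complex \<Rightarrow> real \<Rightarrow> complex set" where
  "Omega_out z0 r = ball z0 r \<inter> {z. norm z > 1}"

definition P_in :: "complex \<Rightarrow> real \<Rightarrow> complex set" where
  "P_in z0 r = ball z0 r \<inter> ball 0 1"

definition U_side :: "(complex \<Rightarrow> real \<Rightarrow> complex set) \<Rightarrow> real \<Rightarrow> real \<Rightarrow> complex \<Rightarrow> enat
    \<Rightarrow> (complex \<Rightarrow> complex) set" where
  "U_side G a b z0 k = {u \<in> Ck a b k. \<not> (\<exists>r>0. \<exists>lam.
      continuous_on (arc a b \<union> G z0 r) lam \<and> lam holomorphic_on G z0 r
      \<and> (\<forall>z\<in>ball z0 r \<inter> arc a b. lam z = u z))}"

definition U2_at where "U2_at a b z0 k = U_side Omega_out a b z0 k"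
definition U3_at where "U3_at a b z0 k = U_side P_in a b z0 k"
definition U4_at where "U4_at a b z0 k = U2_at a b z0 k \<inter> U3_at a b z0 k"
definition U5_at :: "real \<Rightarrow> real \<Rightarrow> complex \<Rightarrow> enat \<Rightarrow> (complex \<Rightarrow> complex) set" where
  "U5_at a b z0 k = {u \<in> Ck a b k. \<not> (\<exists>r>0. \<exists>F.
      F holomorphic_on ball z0 r \<and> (\<forall>z\<in>ball z0 r \<inter> arc a b. F z = u z))}"

definition U2 where "U2 a b k = Ck a b k \<inter> (\<Inter>z0\<in>arc a b. U2_at a b z0 k)"
definition U3 where "U3 a b k = Ck a b k \<inter> (\<Inter>z0\<in>arc a b. U3_at a b z0 k)"
definition U4 where "U4 a b k = Ck a b k \<inter> (\<Inter>z0\<in>arc a b. U4_at a b z0 k)"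
definition U5 where "U5 a b k = Ck a b k \<inter> (\<Inter>z0\<in>arc a b. U5_at a b z0 k)"

definition dense_gdelta_in :: "'a topology \<Rightarrow> 'a set \<Rightarrow> bool" where
  "dense_gdelta_in X S \<longleftrightarrow> gdelta_in X S \<and> X closure_of S = topspace X"

end

theory Submission
  imports Defs "HOL-Complex_Analysis.Complex_Analysis"
begin

text \<open>
  In the coordinate \<open>z = exp (i w)\<close> the arc becomes a real interval and one-sided extendability becomes
  extendability to a half disc. A two-constants estimate shows that a uniform limit of functions with
  uniformly bounded extensions to a half disc extends to the half disc of a quarter of the radius.
  Hence the closures of the sets of functions with an extension of radius \<open>1 / (n + 1)\<close> bounded by
  \<open>M + 1\<close> still consist of extendable functions, and the complement of each class is a countable union
  of closed sets (for the two-sided class one pastes the extensions from the two sides).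

  Density needs no category argument. A real function with an extension to one side has one to the
  other side by reflection, hence is real analytic; the smooth function \<open>g = \<Sum> 2 ^ (- n\<^sup>2) cos (2 ^ n t)\<close>
  is analytic nowhere. So \<open>P + c g\<close> with \<open>P\<close> entire and \<open>c \<noteq> 0\<close> lies in all four classes, and these
  functions are dense by the Weierstrass approximation theorem.
\<close>

section \<open>Extensions to half discs\<close>

text \<open>The sign \<open>s\<close> selects the upper (\<open>s = 1\<close>) or the lower
  (\<open>s = -1\<close>) half. Under \<open>exp (\<i> * w)\<close> the open halves go to the inside
  and the outside of the unit circle, respectively.\<close>

definition half_disc :: "real \<Rightarrow> real \<Rightarrow> real \<Rightarrow> complex set" where
  "half_disc s t r = cball (of_real t) r \<inter> {w. 0 \<le> s * Im w}"

definition open_half_disc :: "real \<Rightarrow> real \<Rightarrow> real \<Rightarrow> complex set" where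
  "open_half_disc s t r = ball (of_real t) r \<inter> {w. 0 < s * Im w}"

text \<open>Continuity is required on the closed half disc, half circle included, so that every
  extension is bounded by compactness.\<close>

definition side_ext :: "real \<Rightarrow> real \<Rightarrow> real \<Rightarrow> (real \<Rightarrow> complex) \<Rightarrow> (complex \<Rightarrow> complex) \<Rightarrow> bool" where
  "side_ext s t r h L \<longleftrightarrow> continuous_on (half_disc s t r) L \<and> L holomorphic_on open_half_disc s t r
     \<and> (\<forall>x. \<bar>x - t\<bar> \<le> r \<longrightarrow> L (of_real x) = h x)"

lemma of_real_in_half_disc: "\<bar>x - t\<bar> \<le> r \<Longrightarrow> of_real x \<in> half_disc s t r"
  by (simp add: half_disc_def dist_of_real dist_real_def abs_minus_commute)

lemma half_disc_mono: "r' \<le> r \<Longrightarrow> half_disc s t r' \<subseteq> half_disc s t r"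
  by (auto simp: half_disc_def)

lemma open_half_disc_mono: "r' \<le> r \<Longrightarrow> open_half_disc s t r' \<subseteq> open_half_disc s t r"
  by (auto simp: open_half_disc_def)

lemma side_ext_mono: "side_ext s t r h L \<Longrightarrow> r' \<le> r \<Longrightarrow> side_ext s t r' h L"
  unfolding side_ext_def
  by (meson continuous_on_subset half_disc_mono holomorphic_on_subset open_half_disc_mono order_trans)

text \<open>Presents the half planes as inner-product half spaces, whose closedness and interior are
  standard.\<close>

lemma inner_imag_unit: "(of_real s * \<i>) \<bullet> w = s * Im w"
  by (simp add: inner_complex_def)

lemma compact_half_disc: "compact (half_disc s t r)"
proof -
  have "{w. 0 \<le> s * Im w} = {w. 0 \<le> (of_real s * \<i>) \<bullet> w}"
    by (simp add: inner_imag_unit)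
  then have "closed {w. 0 \<le> s * Im w}"
    by (metis closed_halfspace_ge)
  then show ?thesis
    unfolding half_disc_def by (simp add: compact_Int_closed)
qed

lemma open_open_half_disc: "open (open_half_disc s t r)"
  unfolding open_half_disc_def
  by (intro open_Int open_ball open_Collect_less continuous_intros)

lemma interior_half_disc:
  assumes "s \<noteq> 0"
  shows "interior (half_disc s t r) = open_half_disc s t r"
proof -
  have "{w. 0 \<le> s * Im w} = {w. 0 \<le> (of_real s * \<i>) \<bullet> w}"
       "{w. 0 < s * Im w} = {w. 0 < (of_real s * \<i>) \<bullet> w}"
    by (simp_all add: inner_imag_unit)
  then show ?thesis
    unfolding half_disc_def open_half_disc_def using assms
    by (simp add: interior_halfspace_ge)
qed

lemma open_half_disc_subset: "open_half_disc s t r \<subseteq> half_disc s t r"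
  by (auto simp: half_disc_def open_half_disc_def)

text \<open>The harmonic function \<open>Re ((1 + i s (w - t) / r)\<^sup>2)\<close> is at most 1 on
  the diameter, at most 0 on the half circle and at least 7/16 near the centre, so it serves as a
  lower bound for the harmonic measure of the diameter.\<close>
lemma two_constants_half_disc:
  fixes f :: "complex \<Rightarrow> complex"
  assumes s: "s = 1 \<or> s = -1" and r: "0 < r"
    and cont: "continuous_on (half_disc s t r) f" and holo: "f holomorphic_on open_half_disc s t r"
    and bound: "\<And>w. w \<in> half_disc s t r \<Longrightarrow> norm (f w) \<le> B"
    and small: "\<And>x. \<bar>x - t\<bar> \<le> r \<Longrightarrow> norm (f (of_real x)) \<le> B * exp (- c)"
    and c: "0 \<le> c" and w: "w \<in> half_disc s t (r / 4)"
  shows "norm (f w) \<le> B * exp (- (7 / 16) * c)"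
proof -
  define q where "q = (\<lambda>w. (1 + \<i> * of_real s * (w - of_real t) / of_real r)\<^sup>2)"
  \<comment> \<open>Since \<open>norm (F w) = norm (f w) * exp (c * Re (q w))\<close>, the factor is
    at most \<open>exp c\<close> on the diameter, which the smallness of \<open>f\<close> absorbs,
    and at most 1 on the half circle. So \<open>F\<close> is bounded by \<open>B\<close> on the
    whole boundary.\<close>
  define F where "F = (\<lambda>w. f w * exp (of_real c * q w))"
  have Req: "Re (q w) = 1 - 2 * (s * Im w) / r - ((Re w - t)\<^sup>2 - (Im w)\<^sup>2) / r\<^sup>2" for w
    using s r by (auto simp: q_def power2_eq_square field_simps)
  have normF: "norm (F w) = norm (f w) * exp (c * Re (q w))" for w
    by (simp add: F_def norm_mult)
  have "norm (f (of_real t)) \<le> B * exp (- c)" using small[of t] r by simp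
  then have B0: "0 \<le> B"
    by (metis exp_gt_zero linorder_not_less mult_neg_pos norm_ge_zero order_trans_rules(23))
  have cd: "(dist (of_real t) w)\<^sup>2 = (Re w - t)\<^sup>2 + (Im w)\<^sup>2" for w
    by (simp add: dist_norm cmod_power2 power2_commute)
  have bnd: "norm (F z) \<le> B" if "z \<in> frontier (half_disc s t r)" for z
  proof -
    have z: "z \<in> half_disc s t r" "z \<notin> open_half_disc s t r"
      using that s interior_half_disc[of s t r] compact_half_disc[of s t r]
      by (auto simp: frontier_def compact_imp_closed)
    then consider "s * Im z = 0" "dist (of_real t) z \<le> r" | "dist (of_real t) z = r" "0 \<le> s * Im z"
      unfolding half_disc_def open_half_disc_def by force
    then show ?thesis
    proof cases
      case 1
      then have im: "Im z = 0" using s by auto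
      then have zr: "z = of_real (Re z)" by (simp add: complex_eq_iff)
      have re: "\<bar>Re z - t\<bar> \<le> r"
        using 1(2) by (subst (asm) zr) (simp add: dist_of_real dist_real_def abs_minus_commute)
      have "Re (q z) \<le> 1" using im by (simp add: Req)
      then have "c * Re (q z) \<le> c" using c by (simp add: mult_left_le)
      then have "norm (F z) \<le> (B * exp (- c)) * exp c"
        unfolding normF using small[OF re] zr[symmetric] B0
        by (intro mult_mono) auto
      then show ?thesis by (simp add: mult.assoc flip: exp_add)
    next
      case 2
      have "(s * Im z)\<^sup>2 \<le> r * (s * Im z)"
      proof -
        have "\<bar>Im z\<bar> \<le> r"
          using 2(1) abs_Im_le_cmod[of "z - of_real t"] by (simp add: dist_norm norm_minus_commute)
        then have "s * Im z \<le> r" using s by auto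
        then show ?thesis using 2(2) by (simp add: power2_eq_square mult_right_mono)
      qed
      moreover have "(s * Im z)\<^sup>2 = (Im z)\<^sup>2" using s by auto
      moreover have "(Re z - t)\<^sup>2 = r\<^sup>2 - (Im z)\<^sup>2" using cd[of z] 2(1) by simp
      \<comment> \<open>With y = \<open>s * Im z\<close>, on the half circle this is 2 (y^2 - r y) /
        r^2, which is nonpositive because 0 \<le> y \<le> r.\<close>
      moreover have "Re (q z) = 2 / r\<^sup>2 * ((Im z)\<^sup>2 - r * (s * Im z))"
        if "(Re z - t)\<^sup>2 = r\<^sup>2 - (Im z)\<^sup>2"
        unfolding Req that using r by (simp add: divide_simps) (simp add: algebra_simps power2_eq_square)
      ultimately have "Re (q z) \<le> 0"
        using r by (simp add: divide_le_0_iff)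
      then have "exp (c * Re (q z)) \<le> 1" using c by (simp add: mult_nonneg_nonpos)
      then have "norm (F z) \<le> B * 1"
        unfolding normF using bound[OF z(1)] B0 by (intro mult_mono) auto
      then show ?thesis by simp
    qed
  qed
  have w': "w \<in> half_disc s t r" using w half_disc_mono[of "r/4" r s t] r by auto
  have "norm (F w) \<le> B"
  proof (rule maximum_modulus_frontier[OF _ _ _ bnd w'])
    show "F holomorphic_on interior (half_disc s t r)"
      using s holo interior_half_disc[of s t r] r
      by (auto simp: F_def q_def intro!: holomorphic_intros)
    show "continuous_on (closure (half_disc s t r)) F"
      using r cont by (auto simp: F_def q_def compact_imp_closed compact_half_disc intro!: continuous_intros)
    show "bounded (half_disc s t r)" by (simp add: compact_half_disc compact_imp_bounded)
  qed
  \<comment> \<open>The subtracted terms are at most 1/2 and 1/16 on the quarter half disc, and 1 -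
    1/2 - 1/16 = 7/16.\<close>
  moreover have "7 / 16 \<le> Re (q w)"
  proof -
    have d: "dist (of_real t) w \<le> r / 4" and pos: "0 \<le> s * Im w"
      using w by (auto simp: half_disc_def)
    have "\<bar>Im w\<bar> \<le> r / 4"
      using d abs_Im_le_cmod[of "w - of_real t"] by (simp add: dist_norm norm_minus_commute)
    then have i: "s * Im w \<le> r / 4" using s by auto
    have "(dist (of_real t) w)\<^sup>2 \<le> (r / 4)\<^sup>2" using d by (intro power_mono) auto
    then have "(Re w - t)\<^sup>2 \<le> (r / 4)\<^sup>2" unfolding cd
      by (smt (verit) zero_le_power2)
    then have "(Re w - t)\<^sup>2 - (Im w)\<^sup>2 \<le> r\<^sup>2 / 16"
      by (simp add: power_divide) (smt (verit) zero_le_power2)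
    then have "((Re w - t)\<^sup>2 - (Im w)\<^sup>2) / r\<^sup>2 \<le> 1 / 16"
      using r by (simp add: divide_simps)
    moreover have "2 * (s * Im w) / r \<le> 1 / 2" using i r by (simp add: field_simps)
    ultimately show ?thesis unfolding Req by linarith
  qed
  then have "(7/16) * c \<le> c * Re (q w)" using mult_right_mono[OF _ c, of "7/16" "Re (q w)"] by (simp add: mult.commute)
  then have "norm (f w) * exp ((7/16) * c) \<le> norm (F w)"
    unfolding normF by (intro mult_left_mono) auto
  ultimately have "norm (f w) * exp ((7/16) * c) \<le> B" by linarith
  then show ?thesis by (simp add: exp_minus field_simps)
qed

section \<open>Limits of uniformly bounded extensions\<close>

text \<open>The two-constants estimate, applied to differences of approximating extensions, makes
  them uniformly Cauchy on the quarter half disc. The common bound \<open>M\<close> is what carries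
  smallness off the diameter.\<close>

lemma side_ext_limit:
  assumes s: "s = 1 \<or> s = -1" and r: "0 < r" and M: "0 < M"
    and approx: "\<And>e. 0 < e \<Longrightarrow> \<exists>v L. side_ext s t r v L \<and> (\<forall>w\<in>half_disc s t r. norm (L w) \<le> M)
                    \<and> (\<forall>x. \<bar>x - t\<bar> \<le> r \<longrightarrow> norm (v x - h x) \<le> e)"
  shows "\<exists>L. side_ext s t (r / 4) h L"
proof -
  \<comment> \<open>With this rate, the difference of two approximants of index at least
    \<open>N\<close> meets the two-constants estimate with \<open>B = 2 * M\<close> and
    \<open>c = N\<close>.\<close>
  let ?P = "\<lambda>n L v. side_ext s t r v L \<and> (\<forall>w\<in>half_disc s t r. norm (L w) \<le> M)
                    \<and> (\<forall>x. \<bar>x - t\<bar> \<le> r \<longrightarrow> norm (v x - h x) \<le> M * exp (- real n))"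
  have "\<exists>L v. ?P n L v" for n :: nat
    using approx[of "M * exp (- real n)"] M by (metis exp_gt_zero mult_pos_pos)
  then obtain L v where P: "\<And>n. ?P n (L n) (v n)" by metis
  have cont: "continuous_on (half_disc s t r) (L n)"
    and holo: "L n holomorphic_on open_half_disc s t r"
    and bound: "w \<in> half_disc s t r \<Longrightarrow> norm (L n w) \<le> M"
    and close: "\<bar>x - t\<bar> \<le> r \<Longrightarrow> norm (L n (of_real x) - h x) \<le> M * exp (- real n)" for n w x
    using P[of n] unfolding side_ext_def by auto
  let ?K = "half_disc s t (r / 4)"
  have *: "norm (L m w - L n w) \<le> 2 * M * exp (- (7 / 16) * real N)"
    if "N \<le> m" "N \<le> n" "w \<in> ?K" for m n N w
  proof (rule two_constants_half_disc[OF s r _ _ _ _ _ that(3)])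
    show "continuous_on (half_disc s t r) (\<lambda>w. L m w - L n w)"
      by (intro continuous_intros cont)
    show "(\<lambda>w. L m w - L n w) holomorphic_on open_half_disc s t r"
      by (intro holomorphic_intros holo)
    show "norm (L m w - L n w) \<le> 2 * M" if "w \<in> half_disc s t r" for w
      using bound[OF that, of m] bound[OF that, of n] norm_triangle_ineq4[of "L m w" "L n w"] by linarith
    show "norm (L m (of_real x) - L n (of_real x)) \<le> 2 * M * exp (- real N)" if "\<bar>x - t\<bar> \<le> r" for x
    proof -
      have "norm (L m (of_real x) - L n (of_real x)) \<le> M * exp (- real m) + M * exp (- real n)"
        using close[OF that, of m] close[OF that, of n]
          norm_triangle_ineq4[of "L m (of_real x) - h x" "L n (of_real x) - h x"] by simp
      also have "\<dots> \<le> M * exp (- real N) + M * exp (- real N)"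
        using \<open>N \<le> m\<close> \<open>N \<le> n\<close> M by (intro add_mono mult_left_mono) auto
      finally show ?thesis by simp
    qed
  qed simp
  have lim: "(\<lambda>N. 2 * M * exp (- (7 / 16) * real N)) \<longlonglongrightarrow> 0"
    by real_asymp
  have "uniformly_Cauchy_on ?K L"
  proof (rule uniformly_Cauchy_onI)
    fix e :: real assume "0 < e"
    then obtain N where N: "2 * M * exp (- (7 / 16) * real N) < e"
      using eventually_happens'[OF sequentially_bot order_tendstoD(2)[OF lim]] by blast
    then have "dist (L m w) (L n w) < e" if "w \<in> ?K" "m \<ge> N" "n \<ge> N" for m n w
      using *[OF that(2,3,1)] N by (simp add: dist_norm)
    then show "\<exists>N. \<forall>w\<in>?K. \<forall>m\<ge>N. \<forall>n\<ge>N. dist (L m w) (L n w) < e"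
      by blast
  qed
  then obtain F where F: "uniform_limit ?K L F sequentially"
    using uniformly_convergent_eq_Cauchy uniformly_convergent_on_def by blast
  have sub: "?K \<subseteq> half_disc s t r" "open_half_disc s t (r/4) \<subseteq> open_half_disc s t r"
    using half_disc_mono[of "r/4" r] open_half_disc_mono[of "r/4" r] r by auto
  have "continuous_on ?K F"
    by (rule uniform_limit_theorem[OF _ F])
      (auto intro!: always_eventually continuous_on_subset[OF cont sub(1)])
  moreover have "F holomorphic_on open_half_disc s t (r/4)"
  proof (rule holomorphic_uniform_sequence[OF open_open_half_disc])
    show "L n holomorphic_on open_half_disc s t (r/4)" for n
      using holo sub(2) holomorphic_on_subset by blast
    fix x assume "x \<in> open_half_disc s t (r/4)"
    then obtain d where "0 < d" "cball x d \<subseteq> open_half_disc s t (r/4)"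
      using open_open_half_disc open_contains_cball by blast
    then show "\<exists>d>0. cball x d \<subseteq> open_half_disc s t (r/4) \<and> uniform_limit (cball x d) L F sequentially"
      using F uniform_limit_on_subset open_half_disc_subset by (meson order_trans)
  qed
  moreover have "F (of_real x) = h x" if "\<bar>x - t\<bar> \<le> r / 4" for x
  proof -
    have "(\<lambda>n. L n (of_real x)) \<longlonglongrightarrow> F (of_real x)"
      using tendsto_uniform_limitI[OF F] of_real_in_half_disc[OF that] by blast
    moreover have "(\<lambda>n. M * exp (- real n)) \<longlonglongrightarrow> 0" by real_asymp
    then have "(\<lambda>n. L n (of_real x) - h x) \<longlonglongrightarrow> 0"
      by (rule Lim_null_comparison[rotated]) (use close[of x] that r in auto)
    then have "(\<lambda>n. L n (of_real x)) \<longlonglongrightarrow> h x"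
      by (rule LIM_zero_cancel)
    ultimately show ?thesis using LIMSEQ_unique by blast
  qed
  ultimately show ?thesis unfolding side_ext_def by blast
qed

section \<open>Pasting and reflecting extensions\<close>

text \<open>Both extensions equal \<open>h\<close> on the diameter, so they glue to a continuous
  function; being holomorphic off the real line, it is holomorphic across it.\<close>

lemma side_ext_paste:
  assumes up: "side_ext 1 t r h L1" and low: "side_ext (-1) t r h L2"
  obtains F where "F holomorphic_on ball (of_real t) r" "\<And>x. \<bar>x - t\<bar> \<le> r \<Longrightarrow> F (of_real x) = h x"
proof -
  define F where "F = (\<lambda>w. if 0 \<le> Im w then L1 w else L2 w)"
  have real_pt: "L1 w = L2 w" if "w \<in> cball (of_real t) r" "Im w = 0" for w
  proof -
    have "w = of_real (Re w)" using that by (simp add: complex_eq_iff)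
    moreover have "\<bar>Re w - t\<bar> \<le> r" using that abs_Re_le_cmod[of "w - of_real t"]
      by (simp add: dist_norm norm_minus_commute)
    ultimately show ?thesis using up low unfolding side_ext_def by metis
  qed
  have "continuous_on (half_disc 1 t r \<union> half_disc (-1) t r) F"
    unfolding F_def
  proof (rule continuous_on_cases)
    show "closed (half_disc 1 t r)" "closed (half_disc (-1) t r)"
      by (auto simp: compact_half_disc compact_imp_closed)
    show "continuous_on (half_disc 1 t r) L1" "continuous_on (half_disc (-1) t r) L2"
      using up low by (auto simp: side_ext_def)
    show "\<forall>w. w \<in> half_disc 1 t r \<and> \<not> 0 \<le> Im w \<or> w \<in> half_disc (- 1) t r \<and> 0 \<le> Im w \<longrightarrow> L1 w = L2 w"
      using real_pt by (auto simp: half_disc_def)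
  qed
  moreover have "half_disc 1 t r \<union> half_disc (-1) t r = cball (of_real t) r"
    by (auto simp: half_disc_def)
  ultimately have cont: "continuous_on (ball (of_real t) r) F"
    by (metis ball_subset_cball continuous_on_subset)
  have "F holomorphic_on ball (of_real t) r"
  proof (rule holomorphic_on_paste_across_line[where d="\<i>" and k=0])
    have "L2 holomorphic_on open_half_disc (-1) t r" using low by (simp add: side_ext_def)
    then show "F holomorphic_on ball (of_real t) r \<inter> {z. \<i> \<bullet> z < 0}"
      by (rule holomorphic_transform[THEN holomorphic_on_subset])
        (auto simp: F_def open_half_disc_def inner_complex_def)
    have "L1 holomorphic_on open_half_disc 1 t r" using up by (simp add: side_ext_def)
    then show "F holomorphic_on ball (of_real t) r \<inter> {z. 0 < \<i> \<bullet> z}"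
      by (rule holomorphic_transform[THEN holomorphic_on_subset])
        (auto simp: F_def open_half_disc_def inner_complex_def)
  qed (use cont in auto)
  moreover have "F (of_real x) = h x" if "\<bar>x - t\<bar> \<le> r" for x
    using up that by (simp add: F_def side_ext_def)
  ultimately show thesis using that by blast
qed

text \<open>Schwarz reflection: conjugating both argument and value swaps the half discs, keeps
  holomorphy and fixes real boundary values.\<close>

lemma side_ext_cnj:
  assumes "side_ext s t r h L" and real: "\<And>x. \<bar>x - t\<bar> \<le> r \<Longrightarrow> cnj (h x) = h x"
  shows "side_ext (- s) t r h (cnj \<circ> L \<circ> cnj)"
proof -
  have dist: "dist (of_real t) (cnj w) = dist (of_real t) w" for w
    by (metis complex_cnj_complex_of_real complex_cnj_diff complex_mod_cnj dist_norm)
  have img: "cnj ` half_disc (- s) t r = half_disc s t r"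
    "cnj ` open_half_disc (- s) t r = open_half_disc s t r"
    unfolding half_disc_def open_half_disc_def
    by (auto simp: dist image_iff intro!: bexI[where x="cnj _"])
  have "continuous_on (half_disc (- s) t r) (cnj \<circ> L \<circ> cnj)"
    using assms(1) unfolding side_ext_def
    by (intro continuous_on_compose) (auto simp: img image_comp[symmetric] intro!: continuous_intros)
  moreover have "cnj \<circ> L \<circ> cnj holomorphic_on open_half_disc (- s) t r"
    by (rule holomorphic_on_compose_cnj_cnj) (use assms(1) in \<open>auto simp: img side_ext_def open_open_half_disc\<close>)
  ultimately show ?thesis using assms unfolding side_ext_def by simp
qed

text \<open>Isolates the lacunary part of a function: subtracting an entire function and dividing by
  a nonzero constant preserves extendability.\<close>

lemma side_ext_cancel_entire:
  assumes "side_ext s t r (\<lambda>x. P (of_real x) + c * g x) L" "P holomorphic_on UNIV" "c \<noteq> 0"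
  shows "side_ext s t r g (\<lambda>w. (L w - P w) / c)"
proof -
  have "P holomorphic_on A" for A using assms(2) holomorphic_on_subset by blast
  moreover from this have "continuous_on A P" for A by (rule holomorphic_on_imp_continuous_on)
  ultimately show ?thesis
    using assms unfolding side_ext_def
    by (auto intro!: continuous_intros holomorphic_intros)
qed

section \<open>A nowhere analytic lacunary series\<close>

text \<open>The termwise derivative of order \<open>l\<close> of the series at \<open>l = 0\<close>:
  the chain rule gives \<open>2 ^ (n * l)\<close>, and each differentiation of the cosine shifts it
  by a quarter period.\<close>

definition lacunary :: "nat \<Rightarrow> real \<Rightarrow> real" where
  "lacunary l t = (\<Sum>n. (1 / 2) ^ (n * n) * 2 ^ (n * l) * cos (2 ^ n * t + real l * (pi / 2)))"

text \<open>Once n > l, n^2 - n l \<ge> n, so the terms lie below a geometric series of ratio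
  1/2.\<close>

lemma summable_lacunary_coeff: "summable (\<lambda>n. (1 / 2 :: real) ^ (n * n) * 2 ^ (n * l))"
proof (rule summable_comparison_test_ev)
  show "\<forall>\<^sub>F n in sequentially. norm ((1 / 2 :: real) ^ (n * n) * 2 ^ (n * l)) \<le> (1 / 2) ^ n"
    unfolding eventually_sequentially
  proof (intro exI[of _ "Suc l"] allI impI)
    fix n assume "Suc l \<le> n"
    then have "n * l + n \<le> n * n"
      by (metis add.commute mult_Suc_right mult_le_mono2)
    then have "(2::real) ^ (n * l) * 2 ^ n \<le> 2 ^ (n * n)"
      unfolding power_add[symmetric] by (intro power_increasing) auto
    then show "norm ((1 / 2 :: real) ^ (n * n) * 2 ^ (n * l)) \<le> (1 / 2) ^ n"
      by (simp add: power_one_over divide_simps)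
  qed
qed (simp add: summable_geometric)

lemma norm_lacunary_term:
  "norm ((1 / 2 :: real) ^ (n * n) * 2 ^ (n * l) * cos x) \<le> (1 / 2) ^ (n * n) * 2 ^ (n * l)"
  by (simp add: abs_mult mult_left_le)

lemma summable_lacunary:
  "summable (\<lambda>n. (1 / 2) ^ (n * n) * 2 ^ (n * l) * cos (2 ^ n * t + real l * (pi / 2)))"
  by (rule summable_comparison_test[OF _ summable_lacunary_coeff[of l]]) (use norm_lacunary_term in blast)

text \<open>Termwise differentiation; the M-test with the coefficients of order \<open>Suc l\<close>
  gives uniform convergence of the differentiated series.\<close>

lemma has_derivative_lacunary: "(lacunary l has_real_derivative lacunary (Suc l) t) (at t)"
proof -
  let ?f = "\<lambda>l n t. (1 / 2) ^ (n * n) * 2 ^ (n * l) * cos (2 ^ n * t + real l * (pi / 2)) :: real"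
  have "((\<lambda>t. \<Sum>n. ?f l n t) has_real_derivative (\<Sum>n. ?f (Suc l) n t)) (at t)"
  proof (rule has_field_derivative_series'(2)[where S=UNIV and ?x0.0=0])
    fix n t
    have "cos (2 ^ n * t + real (Suc l) * (pi / 2)) = - sin (2 ^ n * t + real l * (pi / 2))"
      by (simp add: minus_sin_cos_eq algebra_simps add_divide_distrib)
    then show "(?f l n has_real_derivative ?f (Suc l) n t) (at t within UNIV)"
      by (auto intro!: derivative_eq_intros simp: power_add algebra_simps)
    show "uniformly_convergent_on UNIV (\<lambda>n x. \<Sum>i<n. ?f (Suc l) i x)"
      by (rule Weierstrass_m_test'[OF norm_lacunary_term summable_lacunary_coeff])
    show "summable (\<lambda>n. ?f l n 0)" by (rule summable_lacunary)
  qed auto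
  moreover have "lacunary l = (\<lambda>t. \<Sum>n. ?f l n t)" by (simp add: lacunary_def fun_eq_iff)
  ultimately show ?thesis by (simp only: lacunary_def)
qed

text \<open>All frequencies \<open>2 ^ n\<close> are integers. Periodicity lets the series define a
  function on the full circle.\<close>

lemma lacunary_periodic: "lacunary l (t + 2 * pi * of_int m) = lacunary l t"
proof -
  have "cos (2 ^ n * (t + 2 * pi * of_int m) + real l * (pi / 2)) = cos (2 ^ n * t + real l * (pi / 2))" for n
  proof -
    have "2 ^ n * (t + 2 * pi * of_int m) + real l * (pi / 2)
       = (2 ^ n * t + real l * (pi / 2)) + of_int (2 ^ n * m) * (2 * pi)"
      by (simp add: algebra_simps)
    then show ?thesis
      using cos.plus_of_int[of "2 ^ n * t + real l * (pi / 2)" "2 ^ n * m"]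
      by (simp only: of_real_eq_id id_apply)
  qed
  then show ?thesis unfolding lacunary_def by simp
qed

text \<open>This countable dense set has two uses: as the centres of the half discs that index the
  countable unions, and as the points where high derivatives of the lacunary series are seen to be
  large.\<close>

definition dyadic_angles :: "real set" where
  "dyadic_angles = (\<lambda>(m, N). pi * of_int m / 2 ^ N) ` (UNIV :: (int \<times> nat) set)"

lemma countable_dyadic_angles: "countable dyadic_angles"
  unfolding dyadic_angles_def by simp

lemma dyadic_angles_dense:
  fixes x y :: real
  assumes "x < y"
  obtains q where "q \<in> dyadic_angles" "x < q" "q < y"
proof -
  \<comment> \<open>Two dyadic numbers straddle x / pi at a distance below (y - x) / pi, so the
    upper one lies strictly between x / pi and y / pi.\<close>
  obtain N and j k :: int where *: "j / 2 ^ N < x / pi" "x / pi < k / 2 ^ N"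
      "\<bar>j / 2 ^ N - k / 2 ^ N\<bar> < (y - x) / pi"
    by (rule padic_rational_approximation_straddle[of "(y - x) / pi" 2 "x / pi"])
      (use assms in auto)
  then have "k / 2 ^ N < x / pi + (y - x) / pi" by linarith
  also have "\<dots> = y / pi" by (simp add: field_simps)
  finally have "x < pi * k / 2 ^ N" "pi * k / 2 ^ N < y"
    using * by (simp_all add: field_simps)
  moreover have "pi * k / 2 ^ N \<in> dyadic_angles"
    unfolding dyadic_angles_def by (rule image_eqI[of _ _ "(k, N)"]) auto
  ultimately show thesis using that by blast
qed

text \<open>At a dyadic multiple of \<open>pi\<close> all but finitely many cosines in the derivative of order
  \<open>4 j\<close> equal 1, and the term of index \<open>2 j\<close> alone contributes \<open>2 ^ (4 j * j)\<close>.\<close>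
lemma lacunary_dyadic_lower_bound:
  assumes "q \<in> dyadic_angles"
  obtains N where "\<And>j. N < j \<Longrightarrow> (2 ^ j) ^ (4 * j) - real (Suc N) * (2 ^ N) ^ (4 * j) \<le> lacunary (4 * j) q"
proof -
  obtain m :: int and N where q: "q = pi * m / 2 ^ N"
    using assms by (auto simp: dyadic_angles_def)
  have "(2 ^ j) ^ (4 * j) - real (Suc N) * (2 ^ N) ^ (4 * j) \<le> lacunary (4 * j) q" if "N < j" for j
  proof -
    define a where "a n = (1 / 2 :: real) ^ (n * n) * 2 ^ (n * (4 * j))" for n :: nat
    define f where "f n = a n * cos (2 ^ n * q)" for n
    have a0: "0 \<le> a n" for n by (simp add: a_def)
    \<comment> \<open>Orders divisible by 4 make the phase shift the multiple 2 pi j of the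
      period.\<close>
    have shift: "cos (2 ^ n * q + real (4 * j) * (pi / 2)) = cos (2 ^ n * q)" for n
    proof -
      have "real (4 * j) * (pi / 2) = of_nat j * (2 * pi)" by simp
      then show ?thesis using cos.plus_of_nat[of "2 ^ n * q" j] by (simp only: of_real_eq_id id_apply)
    qed
    have lacunary: "lacunary (4 * j) q = (\<Sum>n. f n)" and summ: "summable f"
      using summable_lacunary[of "4 * j" q] unfolding lacunary_def shift a_def f_def by auto
    \<comment> \<open>For n > N the denominator of \<open>q\<close> cancels with a factor 2 left
      over, so \<open>2 ^ n * q\<close> is an even multiple of pi.\<close>
    have one: "cos (2 ^ n * q) = 1" if n: "N < n" for n
    proof -
      have "2 ^ n = 2 ^ N * (2 * 2 ^ (n - Suc N) :: real)"
        using n by (metis Suc_leI add_diff_inverse_nat less_Suc_eq_le linorder_not_less not_less_eq power_Suc power_add power_Suc2 mult.assoc)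
      then have "2 ^ n * q = of_int (2 ^ (n - Suc N) * m) * (2 * pi)"
        unfolding q by simp
      then show ?thesis by (metis cos_int_2pin mult.commute)
    qed
    \<comment> \<open>All terms beyond \<open>N\<close> are nonnegative, so those other than the one
      of index \<open>2 * j\<close> may be dropped from a lower bound.\<close>
    have "f n \<ge> 0" if "N < n" for n using one[OF that] a0 by (simp add: f_def)
    then have "(\<Sum>n\<in>{..N} \<union> {2 * j}. f n) \<le> (\<Sum>n. f n)"
      by (intro sum_le_suminf summ) auto
    moreover have "(\<Sum>n\<in>{..N} \<union> {2 * j}. f n) = (\<Sum>n\<le>N. f n) + f (2 * j)"
      using \<open>N < j\<close> by (subst sum.union_disjoint) auto
    \<comment> \<open>The index 2 j maximises the exponent 4 j n - n^2 of \<open>a n\<close>, with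
      value 4 j^2.\<close>
    moreover have "f (2 * j) = (2 ^ j) ^ (4 * j)"
    proof -
      have "f (2 * j) = (1 / 2) ^ (4 * j * j) * 2 ^ (4 * j * j + 4 * j * j)"
        using one[of "2 * j"] \<open>N < j\<close> by (simp add: f_def a_def algebra_simps flip: mult_2_right)
      also have "\<dots> = 2 ^ (4 * j * j)"
        unfolding power_add power_one_over by simp
      finally show ?thesis by (simp add: mult.commute flip: power_mult)
    qed
    moreover have "- (real (Suc N) * (2 ^ N) ^ (4 * j)) \<le> (\<Sum>n\<le>N. f n)"
    proof -
      have "- ((2 ^ N) ^ (4 * j)) \<le> f n" if "n \<le> N" for n
      proof -
        have "a n \<le> 1 * (2 ^ (N * (4 * j)))"
          unfolding a_def using that by (intro mult_mono power_le_one power_increasing) auto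
        moreover have "- a n \<le> f n"
          using mult_left_mono[OF cos_ge_minus_one a0, of n "2 ^ n * q"] by (simp add: f_def)
        ultimately show ?thesis by (simp add: power_mult)
      qed
      then have "(\<Sum>n\<le>N. - ((2 ^ N) ^ (4 * j))) \<le> (\<Sum>n\<le>N. f n)"
        by (intro sum_mono) auto
      then show ?thesis by simp
    qed
    ultimately show ?thesis unfolding lacunary by linarith
  qed
  then show thesis using that by blast
qed

text \<open>Cauchy's inequality bounds the derivative of order 4 j at \<open>q\<close> by a constant
  times (4 j)! / \<rho>^(4 j), whereas the dyadic lower bound grows like 2^(4 j^2), which is
  eventually larger.\<close>

lemma lacunary_not_analytic:
  assumes q: "q \<in> dyadic_angles" and r: "0 < r" and F: "F holomorphic_on ball (of_real q) r"
    and eq: "\<And>x. \<bar>x - q\<bar> < r \<Longrightarrow> F (of_real x) = of_real (lacunary 0 x)"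
  shows False
proof -
  \<comment> \<open>On the real segment the complex derivatives of \<open>F\<close> are the
    derivatives of the series, by uniqueness of the derivative along the real line.\<close>
  have hd: "(deriv ^^ l) F (of_real x) = of_real (lacunary l x)" if "\<bar>x - q\<bar> < r" for l x
    using that
  proof (induction l arbitrary: x)
    case 0
    then show ?case using eq by simp
  next
    case (Suc l)
    let ?D = "(deriv ^^ l) F"
    have x: "of_real x \<in> ball (complex_of_real q) r"
      using Suc.prems by (simp add: dist_real_def abs_minus_commute)
    have "?D holomorphic_on ball (of_real q) r"
      by (rule holomorphic_higher_deriv[OF F]) simp
    then have "(?D has_field_derivative deriv ?D (of_real x)) (at (of_real x))"
      using x holomorphic_derivI open_ball by blast
    then have d1: "((\<lambda>x. ?D (of_real x)) has_vector_derivative deriv ?D (of_real x)) (at x)"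
      by (rule has_vector_derivative_real_field)
    have "((\<lambda>x. complex_of_real (lacunary l x)) has_vector_derivative of_real (lacunary (Suc l) x)) (at x)"
      using has_derivative_lacunary[of l x] by (metis has_vector_derivative_of_real)
    then have d2: "((\<lambda>x. ?D (of_real x)) has_vector_derivative of_real (lacunary (Suc l) x)) (at x)"
      by (rule has_vector_derivative_transform_within_open[where S="ball q r"])
        (use Suc in \<open>auto simp: dist_real_def abs_minus_commute\<close>)
    show ?case using vector_derivative_unique_at[OF d1 d2] by simp
  qed
  define \<rho> where "\<rho> = r / 2"
  have \<rho>: "0 < \<rho>" "\<rho> < r" using r by (auto simp: \<rho>_def)
  have F\<rho>: "F holomorphic_on ball (of_real q) \<rho>" "continuous_on (cball (of_real q) \<rho>) F"
    using \<rho>(2) by (auto intro!: holomorphic_on_subset[OF F]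
        continuous_on_subset[OF holomorphic_on_imp_continuous_on[OF F]])
  obtain B where B: "\<And>w. w \<in> cball (of_real q) \<rho> \<Longrightarrow> norm (F w) \<le> B"
    using compact_imp_bounded[OF compact_continuous_image[OF F\<rho>(2) compact_cball]]
    unfolding bounded_iff by blast
  have B0: "0 \<le> B" using B[of "of_real q"] \<rho> by (smt (verit) centre_in_cball norm_ge_zero)
  have upper: "lacunary l q \<le> fact l * B / \<rho> ^ l" for l
  proof -
    have "norm ((deriv ^^ l) F (of_real q)) \<le> fact l * B / \<rho> ^ l"
      by (rule Cauchy_inequality[OF F\<rho> \<rho>(1)]) (use B in \<open>auto simp: dist_norm\<close>)
    then show ?thesis using hd[of q l] r by simp
  qed
  obtain N where N: "\<And>j. N < j \<Longrightarrow> (2 ^ j) ^ (4 * j) - real (Suc N) * (2 ^ N) ^ (4 * j) \<le> lacunary (4 * j) q"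
    using lacunary_dyadic_lower_bound[OF q] by blast
  have "\<forall>\<^sub>F j in sequentially. real (4 * j) / \<rho> \<le> 2 ^ j / 2"
    using \<rho>(1) by real_asymp
  moreover have "\<forall>\<^sub>F j in sequentially. real (Suc N) + B < 2 ^ (4 * j)"
    by real_asymp
  ultimately have "\<forall>\<^sub>F j in sequentially. N < j \<and> real (4 * j) / \<rho> \<le> 2 ^ j / 2 \<and> real (Suc N) + B < 2 ^ (4 * j)"
    using eventually_gt_at_top[of N] by eventually_elim auto
  then obtain j where j: "N < j" "real (4 * j) / \<rho> \<le> 2 ^ j / 2" "real (Suc N) + B < 2 ^ (4 * j)"
    using eventually_happens'[OF sequentially_bot] by blast
  \<comment> \<open>The main term is exactly \<open>2 ^ (4 * j) * ?X\<close>, while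
    \<open>?X\<close> dominates both \<open>(2 ^ N) ^ (4 * j)\<close> and
    \<open>fact (4 * j) / \<rho> ^ (4 * j)\<close>. Hence
    \<open>real (Suc N) + B < 2 ^ (4 * j)\<close> yields the contradiction.\<close>
  let ?X = "(2 ^ j / 2 :: real) ^ (4 * j)"
  have "(2 ^ N :: real) \<le> 2 ^ j / 2"
    using j(1) power_increasing[of "Suc N" j "2::real"] by simp
  then have "(2 ^ N) ^ (4 * j) \<le> ?X" by (intro power_mono) auto
  then have t1: "real (Suc N) * (2 ^ N) ^ (4 * j) \<le> real (Suc N) * ?X"
    by (intro mult_left_mono) auto
  have "fact (4 * j) / \<rho> ^ (4 * j) \<le> real (4 * j) ^ (4 * j) / \<rho> ^ (4 * j)"
    using fact_le_power[of "4 * j", where 'a=real] \<rho> by (intro divide_right_mono) auto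
  also have "\<dots> = (real (4 * j) / \<rho>) ^ (4 * j)" by (simp add: power_divide)
  also have "\<dots> \<le> ?X" using j(2) \<rho> by (intro power_mono) auto
  finally have t2: "B * (fact (4 * j) / \<rho> ^ (4 * j)) \<le> B * ?X"
    using B0 by (rule mult_left_mono)
  have "fact (4 * j) * B / \<rho> ^ (4 * j) = B * (fact (4 * j) / \<rho> ^ (4 * j))" by simp
  then have "(2 ^ j) ^ (4 * j) \<le> real (Suc N) * ?X + B * ?X"
    using N[OF j(1)] upper[of "4 * j"] t1 t2 by linarith
  also have "\<dots> = (real (Suc N) + B) * ?X" by (simp add: algebra_simps)
  also have "\<dots> < 2 ^ (4 * j) * ?X" using j(3) by (intro mult_strict_right_mono) auto
  also have "\<dots> = (2 ^ j) ^ (4 * j)" by (simp add: power_divide)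
  finally show False by simp
qed

section \<open>The topology of \<open>C\<^sup>k\<close>\<close>

text \<open>Derivatives within a nondegenerate interval are unique, so any explicit chain
  \<open>H\<close> that starts with the values of \<open>u\<close> along the arc computes
  \<open>thderiv\<close>.\<close>

lemma thderiv_eqI:
  assumes "a < b" and "\<And>t. t \<in> {a..b} \<Longrightarrow> u (cis t) = H 0 t"
    and "\<And>j t. j < l \<Longrightarrow> t \<in> {a..b} \<Longrightarrow> (H j has_vector_derivative H (Suc j) t) (at t within {a..b})"
    and "t \<in> {a..b}"
  shows "thderiv a b l u t = H l t"
  using assms(3,4)
proof (induction l arbitrary: t)
  case 0
  then show ?case using assms(2) by simp
next
  case (Suc l)
  have "(thderiv a b l u has_vector_derivative H (Suc l) t) (at t within {a..b})"
    by (rule has_vector_derivative_transform[OF Suc.prems(2) _ Suc.prems(1)[OF lessI Suc.prems(2)]])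
      (use Suc in auto)
  then show ?case
    using vector_derivative_within_cbox[of a b t] \<open>a < b\<close> Suc.prems(2) by simp
qed

lemma Ck_derivI:
  assumes "a < b" and "\<And>z. z \<notin> Defs.arc a b \<Longrightarrow> u z = 0" and "\<And>t. t \<in> {a..b} \<Longrightarrow> u (cis t) = H 0 t"
    and H: "\<And>j t. enat j < k \<Longrightarrow> t \<in> {a..b} \<Longrightarrow> (H j has_vector_derivative H (Suc j) t) (at t within {a..b})"
    and "\<And>j. enat j \<le> k \<Longrightarrow> continuous_on {a..b} (H j)"
  shows "u \<in> Ck a b k" and "\<And>l t. enat l \<le> k \<Longrightarrow> t \<in> {a..b} \<Longrightarrow> thderiv a b l u t = H l t"
proof -
  show eq: "thderiv a b l u t = H l t" if "enat l \<le> k" "t \<in> {a..b}" for l t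
  proof (rule thderiv_eqI[where H=H, OF assms(1,3) _ that(2)])
    show "(H j has_vector_derivative H (Suc j) t) (at t within {a..b})" if "j < l" "t \<in> {a..b}" for j t
      using H that \<open>enat l \<le> k\<close> by (metis enat_ord_simps(2) less_le_trans)
  qed
  have "continuous_on {a..b} (thderiv a b l u)" if "enat l \<le> k" for l
    using assms(5)[OF that] eq[OF that] by (subst continuous_on_cong[OF refl]) auto
  moreover have "(thderiv a b l u has_vector_derivative thderiv a b (Suc l) u t) (at t within {a..b})"
    if l: "enat l < k" and t: "t \<in> {a..b}" for l t
  proof -
    have "enat (Suc l) \<le> k" using l by (metis Suc_ile_eq)
    then have "thderiv a b (Suc l) u t = H (Suc l) t" using eq t by blast
    then show ?thesis
      using has_vector_derivative_transform[OF t _ H[OF l t], of "thderiv a b l u"] eq[OF less_imp_le[OF l]]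
      by metis
  qed
  ultimately show "u \<in> Ck a b k" unfolding Ck_def using assms(2) by blast
qed

lemma Ck_diff:
  assumes "a < b" "u \<in> Ck a b k" "v \<in> Ck a b k"
  shows "(\<lambda>z. v z - u z) \<in> Ck a b k"
    and "\<And>l t. enat l \<le> k \<Longrightarrow> t \<in> {a..b} \<Longrightarrow>
      thderiv a b l (\<lambda>z. v z - u z) t = thderiv a b l v t - thderiv a b l u t"
proof -
  note * = Ck_derivI[OF \<open>a < b\<close>, where u = "\<lambda>z. v z - u z" and k = k
      and H = "\<lambda>l t. thderiv a b l v t - thderiv a b l u t"]
  show "(\<lambda>z. v z - u z) \<in> Ck a b k"
    by (rule *(1)) (use assms in \<open>auto simp: Ck_def simp del: thderiv.simps(2) intro!: continuous_intros has_vector_derivative_diff\<close>)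
  show "thderiv a b l (\<lambda>z. v z - u z) t = thderiv a b l v t - thderiv a b l u t"
    if "enat l \<le> k" "t \<in> {a..b}" for l t
    by (rule *(2)[OF _ _ _ _ that]) (use assms in \<open>auto simp: Ck_def simp del: thderiv.simps(2) intro!: continuous_intros has_vector_derivative_diff\<close>)
qed

text \<open>A continuous function on a compact interval is bounded, so the \<open>SUP\<close> is a
  genuine upper bound.\<close>

lemma thderiv_le_seminorm:
  assumes "w \<in> Ck a b k" "enat l \<le> k" "t \<in> {a..b}"
  shows "norm (thderiv a b l w t) \<le> seminormCk a b l w"
proof -
  have "continuous_on {a..b} (\<lambda>t. norm (thderiv a b l w t))"
    using assms by (auto simp: Ck_def intro!: continuous_intros)
  then have "bdd_above ((\<lambda>t. norm (thderiv a b l w t)) ` {a..b})"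
    by (intro bounded_imp_bdd_above compact_imp_bounded compact_continuous_image) auto
  then show ?thesis unfolding seminormCk_def using assms(3) by (rule cSUP_upper[rotated])
qed

lemma seminorm_le:
  assumes "a < b" "\<And>t. t \<in> {a..b} \<Longrightarrow> norm (thderiv a b l w t) \<le> c"
  shows "seminormCk a b l w \<le> c"
  unfolding seminormCk_def by (rule cSUP_least) (use assms in auto)

lemma seminorm_diff_triangle:
  assumes "a < b" "u \<in> Ck a b k" "v \<in> Ck a b k" "w \<in> Ck a b k" "enat l \<le> k"
  shows "seminormCk a b l (\<lambda>z. w z - u z) \<le> seminormCk a b l (\<lambda>z. w z - v z) + seminormCk a b l (\<lambda>z. v z - u z)"
proof (rule seminorm_le[OF assms(1)])
  fix t assume t: "t \<in> {a..b}"
  have "norm (thderiv a b l w t - thderiv a b l u t)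
      \<le> norm (thderiv a b l w t - thderiv a b l v t) + norm (thderiv a b l v t - thderiv a b l u t)"
    by norm
  then show "norm (thderiv a b l (\<lambda>z. w z - u z) t)
      \<le> seminormCk a b l (\<lambda>z. w z - v z) + seminormCk a b l (\<lambda>z. v z - u z)"
    using thderiv_le_seminorm[OF Ck_diff(1)[OF assms(1,3,4)] assms(5) t]
      thderiv_le_seminorm[OF Ck_diff(1)[OF assms(1,2,3)] assms(5) t] assms t
    by (simp add: Ck_diff(2)[where k=k])
qed

lemma seminorm_diff_self:
  assumes "a < b" "u \<in> Ck a b k" "enat l \<le> k"
  shows "seminormCk a b l (\<lambda>z. u z - u z) \<le> 0"
  by (rule seminorm_le[OF assms(1)]) (use Ck_diff(2)[OF assms(1,2,2,3)] in simp)

lemma openin_CkTop_ball: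
  assumes "u \<in> Ck a b k" "enat l \<le> k" "0 < e"
  shows "openin (CkTop a b k) {v \<in> Ck a b k. seminormCk a b l (\<lambda>z. v z - u z) < e}"
  unfolding CkTop_def
  by (rule topology_generated_by_Basis) (use assms in blast)

lemma topspace_CkTop:
  assumes "a < b"
  shows "topspace (CkTop a b k) = Ck a b k"
proof
  show "topspace (CkTop a b k) \<subseteq> Ck a b k"
    unfolding CkTop_def topology_generated_by_topspace by blast
  show "Ck a b k \<subseteq> topspace (CkTop a b k)"
  proof
    fix u assume u: "u \<in> Ck a b k"
    then have "u \<in> {v \<in> Ck a b k. seminormCk a b 0 (\<lambda>z. v z - u z) < 1}"
      using seminorm_diff_self[OF assms u, of 0] by (simp add: zero_enat_def[symmetric])
    then show "u \<in> topspace (CkTop a b k)"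
      using openin_subset[OF openin_CkTop_ball[OF u, of 0 1]] by (auto simp: zero_enat_def[symmetric])
  qed
qed

text \<open>Induction on the generation of the open set. An intersection takes the larger order and
  the smaller radius, so finitely many seminorms suffice even for infinite \<open>k\<close>.\<close>

lemma openin_CkTop_nbhd:
  assumes "a < b" "openin (CkTop a b k) T" "u \<in> T"
  obtains N e where "enat N \<le> k" "0 < e"
    "\<And>v. v \<in> Ck a b k \<Longrightarrow> (\<And>l. l \<le> N \<Longrightarrow> seminormCk a b l (\<lambda>z. v z - u z) < e) \<Longrightarrow> v \<in> T"
proof -
  let ?S = "{{v \<in> Ck a b k. seminormCk a b l (\<lambda>z. v z - u z) < e} | u l e.
        u \<in> Ck a b k \<and> enat l \<le> k \<and> e > 0}"
  let ?N = "\<lambda>T u N e. enat N \<le> k \<and> 0 < e \<and>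
    (\<forall>v\<in>Ck a b k. (\<forall>l\<le>N. seminormCk a b l (\<lambda>z. v z - u z) < e) \<longrightarrow> v \<in> T)"
  have "generate_topology_on ?S T"
    using assms(2) unfolding CkTop_def by (rule openin_topology_generated_by)
  then have "\<forall>u\<in>T. \<exists>N e. ?N T u N e"
  proof induction
    case Empty
    then show ?case by simp
  next
    case (Int A B)
    show ?case
    proof
      fix u assume "u \<in> A \<inter> B"
      then obtain N e N' e' where "?N A u N e" "?N B u N' e'" using Int by blast
      then have "?N (A \<inter> B) u (max N N') (min e e')" by (auto simp: max_def)
      then show "\<exists>N e. ?N (A \<inter> B) u N e" by blast
    qed
  next
    case (UN K)
    then show ?case by (meson Union_iff)
  next
    case (Basis B)
    then obtain u0 l e0 where B: "B = {v \<in> Ck a b k. seminormCk a b l (\<lambda>z. v z - u0 z) < e0}"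
      and *: "u0 \<in> Ck a b k" "enat l \<le> k" "e0 > 0" by blast
    show ?case
    proof
      fix u assume "u \<in> B"
      then have u: "u \<in> Ck a b k" "seminormCk a b l (\<lambda>z. u z - u0 z) < e0" by (auto simp: B)
      \<comment> \<open>The radius is what the triangle inequality leaves of \<open>e0\<close> after
        moving the centre from \<open>u0\<close> to \<open>u\<close>.\<close>
      have "?N B u l (e0 - seminormCk a b l (\<lambda>z. u z - u0 z))"
      proof (intro conjI ballI impI)
        fix v assume v: "v \<in> Ck a b k"
          "\<forall>j\<le>l. seminormCk a b j (\<lambda>z. v z - u z) < e0 - seminormCk a b l (\<lambda>z. u z - u0 z)"
        then have "seminormCk a b l (\<lambda>z. v z - u0 z) < e0"
          using seminorm_diff_triangle[OF \<open>a < b\<close> *(1) u(1) v(1) *(2)] by fastforce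
        then show "v \<in> B" using v by (simp add: B)
      qed (use * u in auto)
      then show "\<exists>N e. ?N B u N e" by blast
    qed
  qed
  then show thesis using that assms(3) by metis
qed

text \<open>The seminorm of order 0 is available for every \<open>k\<close> and controls the
  distance on the arc; off the arc both functions vanish.\<close>

lemma Ck_closure_uniform_approx:
  assumes "a < b" "u \<in> CkTop a b k closure_of S" "0 < e"
  obtains v where "v \<in> S" "v \<in> Ck a b k" "\<And>z. norm (v z - u z) \<le> e"
proof -
  have u: "u \<in> Ck a b k" using assms(2) topspace_CkTop[OF assms(1)] by (metis in_closure_of)
  let ?T = "{v \<in> Ck a b k. seminormCk a b 0 (\<lambda>z. v z - u z) < e}"
  have op: "openin (CkTop a b k) ?T"
    by (rule openin_CkTop_ball) (use u assms in \<open>auto simp: zero_enat_def[symmetric]\<close>)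
  have uT: "u \<in> ?T" using seminorm_diff_self[OF assms(1) u, of 0] u \<open>0 < e\<close>
    by (simp add: zero_enat_def[symmetric])
  have "\<forall>T. u \<in> T \<and> openin (CkTop a b k) T \<longrightarrow> (\<exists>v. v \<in> S \<and> v \<in> T)"
    using assms(2) by (simp add: in_closure_of)
  from this[rule_format, OF conjI[OF uT op]] obtain v where v: "v \<in> S" "v \<in> ?T"
    by auto
  have "norm (v z - u z) \<le> e" for z
  proof (cases "z \<in> Defs.arc a b")
    case True
    then obtain t where "t \<in> {a..b}" "z = cis t" by (auto simp: arc_def)
    then show ?thesis
      using thderiv_le_seminorm[OF Ck_diff(1)[OF \<open>a < b\<close> u], of v 0 t] v
      by (auto simp: zero_enat_def[symmetric])
  next
    case False
    then show ?thesis using u v \<open>0 < e\<close> by (auto simp: Ck_def)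
  qed
  then show thesis using that v by blast
qed

text \<open>Reduces density to simultaneous uniform approximation of finitely many
  derivatives.\<close>

lemma CkTop_denseI:
  assumes "a < b" "S \<subseteq> Ck a b k"
    and "\<And>u N e. u \<in> Ck a b k \<Longrightarrow> enat N \<le> k \<Longrightarrow> 0 < e \<Longrightarrow>
      \<exists>v\<in>S. \<forall>l\<le>N. \<forall>t\<in>{a..b}. norm (thderiv a b l v t - thderiv a b l u t) \<le> e"
  shows "CkTop a b k closure_of S = topspace (CkTop a b k)"
proof (rule subset_antisym[OF closure_of_subset_topspace], rule subsetI)
  fix u assume "u \<in> topspace (CkTop a b k)"
  then have u: "u \<in> Ck a b k" by (simp add: topspace_CkTop assms)
  have "\<exists>v. v \<in> S \<and> v \<in> T" if T: "openin (CkTop a b k) T" "u \<in> T" for T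
  proof -
    obtain N e where N: "enat N \<le> k" "0 < e"
      "\<And>v. v \<in> Ck a b k \<Longrightarrow> (\<And>l. l \<le> N \<Longrightarrow> seminormCk a b l (\<lambda>z. v z - u z) < e) \<Longrightarrow> v \<in> T"
      using openin_CkTop_nbhd[OF assms(1) T] by blast
    \<comment> \<open>Half of \<open>e\<close> is used because passing to the supremum preserves
      only the weak inequality.\<close>
    obtain v where v: "v \<in> S" "\<forall>l\<le>N. \<forall>t\<in>{a..b}. norm (thderiv a b l v t - thderiv a b l u t) \<le> e / 2"
      using assms(3)[OF u N(1), of "e / 2"] N(2) by auto
    have "seminormCk a b l (\<lambda>z. v z - u z) < e" if "l \<le> N" for l
    proof -
      have "enat l \<le> k" using that N(1) by (metis enat_ord_simps(1) order_trans)
      then have "seminormCk a b l (\<lambda>z. v z - u z) \<le> e / 2"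
        using v that assms(2) Ck_diff(2)[OF assms(1) u] by (intro seminorm_le[OF assms(1)]) auto
      then show ?thesis using N(2) by simp
    qed
    then show ?thesis using N(3) v assms(2) by blast
  qed
  then show "u \<in> CkTop a b k closure_of S"
    using \<open>u \<in> topspace (CkTop a b k)\<close> unfolding in_closure_of by blast
qed

section \<open>Approximation by entire functions\<close>

text \<open>The difference of the parameters is a positive multiple of 2 pi, which fits into the
  interval only if it is the whole length.\<close>

lemma cis_eq_imp_endpoints:
  assumes "0 \<le> a" "b \<le> 2 * pi" "x \<in> {a..b}" "y \<in> {a..b}" "cis x = cis y" "x < y"
  shows "x = a \<and> y = b"
proof -
  obtain n :: int where n: "y = x + 2 * pi * n"
    using assms(5) sin_cos_eq_iff[of y x] by (auto simp: complex_eq_iff)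
  then have "0 < pi * n" using \<open>x < y\<close> by simp
  then have "1 \<le> n" by (simp add: zero_less_mult_iff)
  then have "2 * pi * 1 \<le> 2 * pi * n" by (intro mult_left_mono) auto
  then have "x + 2 * pi \<le> y" using n by linarith
  then show ?thesis using assms(1-4) by auto
qed

text \<open>At most the two endpoints are identified by \<open>cis\<close>; if \<open>h\<close>
  agrees there, the arbitrary choice of a parameter is harmless.\<close>

lemma lift_to_arc:
  assumes "0 \<le> a" "b \<le> 2 * pi" and "cis a = cis b \<Longrightarrow> h a = h b"
  obtains u where "\<And>z. z \<notin> Defs.arc a b \<Longrightarrow> u z = 0" "\<And>t. t \<in> {a..b} \<Longrightarrow> u (cis t) = h t"
proof -
  define u where "u z = (if z \<in> Defs.arc a b then h (SOME t. t \<in> {a..b} \<and> cis t = z) else 0)" for z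
  have "u (cis t) = h t" if t: "t \<in> {a..b}" for t
  proof -
    define t' where "t' = (SOME t'. t' \<in> {a..b} \<and> cis t' = cis t)"
    have t': "t' \<in> {a..b}" "cis t' = cis t"
      unfolding t'_def using someI[of "\<lambda>t'. t' \<in> {a..b} \<and> cis t' = cis t" t] t by auto
    have "h t' = h t"
    proof (cases t t' rule: linorder_cases)
      case less
      then show ?thesis using cis_eq_imp_endpoints[OF assms(1,2) t t'(1)] t' assms(3) by auto
    next
      case greater
      then show ?thesis using cis_eq_imp_endpoints[OF assms(1,2) t'(1) t] t' assms(3) by auto
    qed simp
    moreover have "cis t \<in> Defs.arc a b" using t by (auto simp: arc_def)
    ultimately show ?thesis by (simp add: u_def t'_def)
  qed
  then show thesis using that[of u] by (simp add: u_def)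
qed

text \<open>Weierstrass approximation of the real and imaginary parts; a real polynomial is entire
  when evaluated at complex arguments.\<close>

lemma entire_approx_continuous:
  fixes h :: "real \<Rightarrow> complex"
  assumes "continuous_on {a..b} h" "0 < e"
  obtains P where "P holomorphic_on UNIV" "\<And>t. t \<in> {a..b} \<Longrightarrow> norm (P (of_real t) - h t) < e"
proof -
  have *: "\<exists>Q. Q holomorphic_on UNIV \<and> (\<forall>t\<in>{a..b}. norm (Q (of_real t) - of_real (f t)) < e / 2)"
    if f: "continuous_on {a..b} f" for f :: "real \<Rightarrow> real"
  proof -
    obtain g where g: "real_polynomial_function g" "\<And>x. x \<in> {a..b} \<Longrightarrow> \<bar>f x - g x\<bar> < e / 2"
      using Stone_Weierstrass_real_polynomial_function[OF compact_Icc f, of "e / 2"] \<open>0 < e\<close> by auto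
    obtain c n where gn: "g = (\<lambda>x. \<Sum>i\<le>n. c i * x ^ i)"
      using g(1) real_polynomial_function_iff_sum by blast
    let ?Q = "\<lambda>w. \<Sum>i\<le>n. complex_of_real (c i) * w ^ i"
    have "?Q holomorphic_on UNIV" by (intro holomorphic_intros)
    moreover have "norm (?Q (of_real t) - of_real (f t)) < e / 2" if "t \<in> {a..b}" for t
    proof -
      have "?Q (of_real t) - of_real (f t) = of_real (g t - f t)" by (simp add: gn)
      then show ?thesis using g(2)[OF that] by (simp only: norm_of_real abs_minus_commute)
    qed
    ultimately show ?thesis by blast
  qed
  obtain Q1 where Q1: "Q1 holomorphic_on UNIV" "\<forall>t\<in>{a..b}. norm (Q1 (of_real t) - of_real (Re (h t))) < e / 2"
    using *[of "\<lambda>t. Re (h t)"] assms(1) continuous_on_Re by blast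
  obtain Q2 where Q2: "Q2 holomorphic_on UNIV" "\<forall>t\<in>{a..b}. norm (Q2 (of_real t) - of_real (Im (h t))) < e / 2"
    using *[of "\<lambda>t. Im (h t)"] assms(1) continuous_on_Im by blast
  show thesis
  proof (rule that)
    show "(\<lambda>w. Q1 w + \<i> * Q2 w) holomorphic_on UNIV"
      using Q1 Q2 by (auto intro!: holomorphic_intros)
    fix t assume t: "t \<in> {a..b}"
    have "Q1 (of_real t) + \<i> * Q2 (of_real t) - h t
        = (Q1 (of_real t) - of_real (Re (h t))) + \<i> * (Q2 (of_real t) - of_real (Im (h t)))"
      by (simp add: algebra_simps flip: complex_eq)
    then have "norm (Q1 (of_real t) + \<i> * Q2 (of_real t) - h t)
        \<le> norm (Q1 (of_real t) - of_real (Re (h t))) + norm (Q2 (of_real t) - of_real (Im (h t)))"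
      by (metis norm_triangle_ineq norm_mult norm_ii mult_1)
    then show "norm (Q1 (of_real t) + \<i> * Q2 (of_real t) - h t) < e"
      using Q1 Q2 t by fastforce
  qed
qed

lemma has_vector_derivative_higher_deriv:
  assumes "P holomorphic_on UNIV"
  shows "((\<lambda>t. (deriv ^^ l) P (of_real t)) has_vector_derivative (deriv ^^ Suc l) P (of_real t)) (at t within A)"
proof -
  have "(deriv ^^ l) P holomorphic_on UNIV"
    by (rule holomorphic_higher_deriv[OF assms open_UNIV])
  then have "((deriv ^^ l) P has_field_derivative (deriv ^^ Suc l) P (of_real t)) (at (of_real t))"
    by (simp add: holomorphic_derivI)
  then show ?thesis
    by (rule has_vector_derivative_at_within[OF has_vector_derivative_real_field])
qed

text \<open>Induction on the order: approximate the chain starting at \<open>H 1\<close>, take a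
  primitive that agrees with \<open>H 0\<close> at \<open>a\<close>, and bound the remaining error
  by the mean value inequality.\<close>

lemma entire_approx_derivatives:
  fixes H :: "nat \<Rightarrow> real \<Rightarrow> complex"
  assumes "a < b" and "0 < e" and "continuous_on {a..b} (H n)"
    and "\<And>l t. l < n \<Longrightarrow> t \<in> {a..b} \<Longrightarrow> (H l has_vector_derivative H (Suc l) t) (at t within {a..b})"
  shows "\<exists>P. P holomorphic_on UNIV \<and> (\<forall>l\<le>n. \<forall>t\<in>{a..b}. norm ((deriv ^^ l) P (of_real t) - H l t) < e)"
  using assms(2-)
proof (induction n arbitrary: H e)
  case 0
  then obtain P where "P holomorphic_on UNIV" "\<And>t. t \<in> {a..b} \<Longrightarrow> norm (P (of_real t) - H 0 t) < e"
    using entire_approx_continuous by blast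
  then show ?case by auto
next
  case (Suc n)
  \<comment> \<open>This makes the integrated error \<open>d * (b - a)\<close> smaller than
    \<open>e\<close> and also keeps \<open>d \<le> e\<close> for the higher orders.\<close>
  define d where "d = e / (1 + (b - a))"
  have d: "0 < d" "d * (b - a) < e" "d \<le> e"
    using Suc.prems(1) \<open>a < b\<close> by (auto simp: d_def field_simps)
  obtain Q where Q: "Q holomorphic_on UNIV"
    "\<forall>l\<le>n. \<forall>t\<in>{a..b}. norm ((deriv ^^ l) Q (of_real t) - H (Suc l) t) < d"
    using Suc.IH[OF d(1), of "\<lambda>l. H (Suc l)"] Suc.prems by auto
  obtain G where G: "\<And>w. (G has_field_derivative Q w) (at w)"
    using holomorphic_convex_primitive'[OF convex_UNIV open_UNIV Q(1)] by auto
  define P where "P w = G w + (H 0 a - G (of_real a))" for w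
  have P: "(P has_field_derivative Q w) (at w)" for w
    unfolding P_def using G by (auto intro!: derivative_eq_intros)
  have holP: "P holomorphic_on UNIV"
    using P by (auto simp: holomorphic_on_def field_differentiable_def)
  have dP: "deriv P = Q" by (intro ext DERIV_imp_deriv P)
  have "norm (P (of_real t) - H 0 t) < e" if t: "t \<in> {a..b}" for t
  proof -
    have "norm ((P (of_real t) - H 0 t) - (P (of_real a) - H 0 a)) \<le> d * norm (t - a)"
    proof (rule differentiable_bound[where S="{a..b}" and f'="\<lambda>t h. h *\<^sub>R (Q (of_real t) - H 1 t)"])
      fix x assume x: "x \<in> {a..b}"
      have "((\<lambda>t. P (of_real t)) has_vector_derivative Q (of_real x)) (at x within {a..b})"
        by (rule has_vector_derivative_at_within[OF has_vector_derivative_real_field[OF P]])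
      then show "((\<lambda>t. P (of_real t) - H 0 t) has_derivative (\<lambda>h. h *\<^sub>R (Q (of_real x) - H 1 x))) (at x within {a..b})"
        using Suc.prems(3)[OF _ x, of 0]
        unfolding has_vector_derivative_def[symmetric] by (auto intro!: has_vector_derivative_diff)
      have "norm (Q (of_real x) - H 1 x) \<le> d" using Q(2) x by (force dest: spec[of _ 0])
      then show "onorm (\<lambda>h. h *\<^sub>R (Q (of_real x) - H 1 x)) \<le> d"
        by (intro onorm_le) (simp add: mult.commute[of d] mult_left_mono)
    qed (use t \<open>a < b\<close> in auto)
    also have "\<dots> \<le> d * (b - a)" using t d(1) by (intro mult_left_mono) auto
    finally show ?thesis using d(2) by (simp add: P_def)
  qed
  moreover have "norm ((deriv ^^ Suc l) P (of_real t) - H (Suc l) t) < e" if "l \<le> n" "t \<in> {a..b}" for l t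
  proof -
    have "(deriv ^^ Suc l) P = (deriv ^^ l) Q" by (simp only: funpow_Suc_right comp_apply dP)
    then show ?thesis using Q(2) that d(3) by fastforce
  qed
  ultimately have "\<forall>l\<le>Suc n. \<forall>t\<in>{a..b}. norm ((deriv ^^ l) P (of_real t) - H l t) < e"
    by (metis Suc_le_mono funpow_0 not0_implies_Suc)
  then show ?case using holP by blast
qed

text \<open>If the arc is the whole circle, the approximant has to take equal values at \<open>a\<close> and \<open>b\<close>
  in order to define a function on the circle; a small linear term achieves this.\<close>
lemma entire_approx_matching_endpoints:
  fixes H :: "nat \<Rightarrow> real \<Rightarrow> complex"
  assumes "a < b" and "0 < e" and "continuous_on {a..b} (H n)"
    and "\<And>l t. l < n \<Longrightarrow> t \<in> {a..b} \<Longrightarrow> (H l has_vector_derivative H (Suc l) t) (at t within {a..b})"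
  obtains P where "P holomorphic_on UNIV"
    "\<And>l t. l \<le> n \<Longrightarrow> t \<in> {a..b} \<Longrightarrow> norm ((deriv ^^ l) P (of_real t) - H l t) \<le> e"
    "P (of_real b) - P (of_real a) = H 0 b - H 0 a"
proof -
  \<comment> \<open>\<open>R\<close> bounds 1 and |t| on the interval, hence every derivative of the
    identity there.\<close>
  define R where "R = 1 + \<bar>a\<bar> + \<bar>b\<bar>"
  \<comment> \<open>Chosen so that the approximation error \<open>d\<close> and the cost
    \<open>2 * d / (b - a) * R\<close> of the linear correction add up to \<open>e\<close>.\<close>
  define d where "d = e / (1 + 2 * R / (b - a))"
  have R: "1 \<le> R" by (simp add: R_def)
  have pos: "0 < 1 + 2 * R / (b - a)" using R \<open>a < b\<close> by (intro add_pos_nonneg) auto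
  then have "d * (1 + 2 * R / (b - a)) = e" by (simp add: d_def)
  moreover have "d * (1 + 2 * R / (b - a)) = d + 2 * d / (b - a) * R" by (simp add: distrib_left)
  moreover have "0 < d" using \<open>0 < e\<close> pos by (simp add: d_def)
  ultimately have d: "0 < d" "d + 2 * d / (b - a) * R = e" by simp_all
  obtain P where P: "P holomorphic_on UNIV"
    and PH: "\<And>l t. l \<le> n \<Longrightarrow> t \<in> {a..b} \<Longrightarrow> norm ((deriv ^^ l) P (of_real t) - H l t) < d"
    using entire_approx_derivatives[OF assms(1) d(1), of H n] assms(3,4) by blast
  \<comment> \<open>The slope that removes the mismatch at the endpoints, which is at most
    \<open>2 * d\<close>.\<close>
  define c where "c = ((P (of_real b) - H 0 b) - (P (of_real a) - H 0 a)) / of_real (b - a)"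
  have "norm ((P (of_real b) - H 0 b) - (P (of_real a) - H 0 a)) \<le> 2 * d"
    using PH[of 0 a] PH[of 0 b] \<open>a < b\<close>
      norm_triangle_ineq4[of "P (of_real b) - H 0 b" "P (of_real a) - H 0 a"] by simp
  then have c: "norm c \<le> 2 * d / (b - a)"
    using \<open>a < b\<close> by (simp add: c_def norm_divide divide_right_mono flip: of_real_diff)
  have hd: "(deriv ^^ l) (\<lambda>w. P w - c * w) w = (deriv ^^ l) P w - (deriv ^^ l) (\<lambda>w. c * w) w" for l w
    by (rule higher_deriv_diff[OF P _ open_UNIV]) (auto intro!: holomorphic_intros)
  show thesis
  proof (rule that)
    show "(\<lambda>w. P w - c * w) holomorphic_on UNIV" using P by (auto intro!: holomorphic_intros)
    have "c * of_real (b - a) = (P (of_real b) - H 0 b) - (P (of_real a) - H 0 a)"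
      using \<open>a < b\<close> by (simp add: c_def flip: of_real_diff)
    then show "(P (of_real b) - c * of_real b) - (P (of_real a) - c * of_real a) = H 0 b - H 0 a"
      by (simp add: algebra_simps)
    fix l t assume l: "l \<le> n" and t: "t \<in> {a..b}"
    have "norm ((deriv ^^ l) (\<lambda>w. c * w) (of_real t)) \<le> norm c * R"
    proof -
      have "\<bar>t\<bar> \<le> R" using t by (auto simp: R_def)
      then have "norm c * \<bar>t\<bar> \<le> norm c * R" "norm c * 1 \<le> norm c * R"
        using R by (intro mult_left_mono; simp)+
      then show ?thesis unfolding higher_deriv_linear using R by (auto simp: norm_mult)
    qed
    also have "\<dots> \<le> 2 * d / (b - a) * R" using c R by (intro mult_right_mono) auto
    finally have lin: "norm ((deriv ^^ l) (\<lambda>w. c * w) (of_real t)) \<le> 2 * d / (b - a) * R" .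
    have swap: "x - y - z = (x - z) - y" for x y z :: complex by simp
    show "norm ((deriv ^^ l) (\<lambda>w. P w - c * w) (of_real t) - H l t) \<le> e"
      using PH[OF l t] d(2) norm_triangle_ineq4[of "(deriv ^^ l) P (of_real t) - H l t" "(deriv ^^ l) (\<lambda>w. c * w) (of_real t)"]
      lin unfolding hd swap[of _ _ "H l t"] by linarith
  qed
qed

lemma lacunary_bounded:
  obtains C where "0 < C" "\<And>l t. l \<le> N \<Longrightarrow> \<bar>lacunary l t\<bar> \<le> C"
proof -
  define c where "c l = (\<Sum>n. (1 / 2 :: real) ^ (n * n) * 2 ^ (n * l))" for l
  have c0: "0 \<le> c l" for l unfolding c_def by (intro suminf_nonneg summable_lacunary_coeff) auto
  have "\<bar>lacunary l t\<bar> \<le> 1 + (\<Sum>l\<le>N. c l)" if "l \<le> N" for l t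
  proof -
    have "norm (lacunary l t) \<le> c l"
      unfolding lacunary_def c_def by (rule norm_suminf_le[OF norm_lacunary_term summable_lacunary_coeff])
    also have "\<dots> \<le> (\<Sum>l\<le>N. c l)" using c0 that by (intro member_le_sum) auto
    finally show ?thesis by simp
  qed
  moreover have "0 < 1 + (\<Sum>l\<le>N. c l)" using c0 by (intro add_pos_nonneg sum_nonneg) auto
  ultimately show thesis using that by blast
qed

text \<open>\<open>P\<close> is entire in the angle \<open>t\<close>, not in the point
  \<open>cis t\<close>. If the arc closes up, agreement at the two ends is implicit in
  \<open>v\<close> being a function of \<open>cis t\<close>.\<close>

definition entire_plus_lacunary :: "real \<Rightarrow> real \<Rightarrow> (complex \<Rightarrow> complex) set" where
  "entire_plus_lacunary a b = {v. \<exists>P d. P holomorphic_on UNIV \<and> d \<noteq> 0 \<and>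
     (\<forall>t\<in>{a..b}. v (cis t) = P (of_real t) + d * of_real (lacunary 0 t))}"

lemma entire_plus_lacunary_approx:
  assumes ab: "0 \<le> a" "a < b" "b \<le> 2 * pi" and u: "u \<in> Ck a b k" and N: "enat N \<le> k" and e: "0 < e"
  shows "\<exists>v \<in> Ck a b k \<inter> entire_plus_lacunary a b.
      \<forall>l\<le>N. \<forall>t\<in>{a..b}. norm (thderiv a b l v t - thderiv a b l u t) \<le> e"
proof -
  have le: "enat l \<le> k" if "l \<le> N" for l using that N by (metis enat_ord_simps(1) order_trans)
  have lt: "enat l < k" if "l < N" for l using that N by (metis enat_ord_simps(2) less_le_trans)
  obtain P where P: "P holomorphic_on UNIV"
    and PH: "\<And>l t. l \<le> N \<Longrightarrow> t \<in> {a..b} \<Longrightarrow> norm ((deriv ^^ l) P (of_real t) - thderiv a b l u t) \<le> e / 2"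
    and Pab: "P (of_real b) - P (of_real a) = thderiv a b 0 u b - thderiv a b 0 u a"
    using entire_approx_matching_endpoints[OF ab(2), of "e / 2" "\<lambda>l. thderiv a b l u" N] e u N lt
    unfolding Ck_def by (auto simp del: thderiv.simps)
  obtain C where C: "0 < C" "\<And>l t. l \<le> N \<Longrightarrow> \<bar>lacunary l t\<bar> \<le> C" using lacunary_bounded by blast
  \<comment> \<open>The lacunary perturbation gets half of the error budget in all orders up to
    \<open>N\<close>.\<close>
  define d where "d = e / (2 * C)"
  have d: "0 < d" "d * C = e / 2" using e C(1) by (auto simp: d_def)
  define H where "H l t = (deriv ^^ l) P (of_real t) + of_real d * of_real (lacunary l t)" for l t
  have H: "(H l has_vector_derivative H (Suc l) t) (at t within {a..b})" for l t
  proof -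
    have "((\<lambda>t. complex_of_real (lacunary l t)) has_vector_derivative of_real (lacunary (Suc l) t)) (at t within {a..b})"
      using has_derivative_lacunary[of l t]
      by (metis has_vector_derivative_of_real has_vector_derivative_at_within)
    then show ?thesis unfolding H_def
      by (intro has_vector_derivative_add has_vector_derivative_mult_right has_vector_derivative_higher_deriv P)
  qed
  have H_cont: "continuous_on {a..b} (H l)" for l
    using H by (meson continuous_on_eq_continuous_within has_vector_derivative_continuous)
  \<comment> \<open>The ends coincide only for the full circle; there the lacunary series is
    periodic and \<open>Pab\<close> matches the values of \<open>P\<close>.\<close>
  have "H 0 a = H 0 b" if cis: "cis a = cis b"
  proof -
    have "\<not> (a \<noteq> 0 \<or> b \<noteq> 2 * pi)"
      using ab cis cis_eq_imp_endpoints[of 0 "2 * pi" a b] by auto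
    then have "lacunary 0 b = lacunary 0 a" using lacunary_periodic[of 0 0 1] by simp
    then show ?thesis using Pab cis by (simp add: H_def)
  qed
  then obtain v where v: "\<And>z. z \<notin> Defs.arc a b \<Longrightarrow> v z = 0" "\<And>t. t \<in> {a..b} \<Longrightarrow> v (cis t) = H 0 t"
    using lift_to_arc[OF ab(1,3), of "H 0"] by blast
  have vCk: "v \<in> Ck a b k"
    by (rule Ck_derivI(1)[where H=H, OF ab(2)]) (use v H H_cont in auto)
  have thv: "thderiv a b l v t = H l t" if "enat l \<le> k" "t \<in> {a..b}" for l t
    by (rule Ck_derivI(2)[where H=H and k=k, OF ab(2) _ _ _ _ that]) (use v H H_cont in auto)
  have "v \<in> entire_plus_lacunary a b"
    unfolding entire_plus_lacunary_def using P v(2) d(1)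
    by (auto simp: H_def intro!: exI[of _ P] exI[of _ "complex_of_real d"])
  moreover have "norm (thderiv a b l v t - thderiv a b l u t) \<le> e" if "l \<le> N" "t \<in> {a..b}" for l t
  proof -
    have "norm (of_real d * complex_of_real (lacunary l t)) \<le> d * C"
      using C(2)[OF that(1)] d(1) by (simp add: norm_mult mult_left_mono)
    then have "norm (H l t - thderiv a b l u t) \<le> e"
      unfolding H_def using PH[OF that] d(2)
        norm_triangle_ineq[of "(deriv ^^ l) P (of_real t) - thderiv a b l u t" "of_real d * complex_of_real (lacunary l t)"]
      by (simp add: algebra_simps)
    then show ?thesis using thv[OF le[OF that(1)] that(2)] by simp
  qed
  ultimately show ?thesis using vCk by blast
qed

section \<open>Logarithmic coordinates\<close>

text \<open>Together with the exterior version, this puts both sides in the form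
  \<open>s * norm z < s\<close>, so one argument with a sign covers both.\<close>

lemma P_in_eq: "P_in = (\<lambda>z0 r. ball z0 r \<inter> {z. 1 * norm z < (1::real)})"
  by (auto simp: P_in_def fun_eq_iff)

lemma Omega_out_eq: "Omega_out = (\<lambda>z0 r. ball z0 r \<inter> {z. (-1) * norm z < (-1::real)})"
  by (auto simp: Omega_out_def fun_eq_iff)

text \<open>The modulus of \<open>exp (\<i> * w)\<close> is \<open>exp (- Im w)\<close>.\<close>

lemma norm_exp_i_side:
  assumes "s = 1 \<or> s = -1"
  shows "s * norm (exp (\<i> * w)) < s \<longleftrightarrow> 0 < s * Im w"
  using assms by auto

lemma exp_i_of_real: "exp (\<i> * of_real x) = cis x"
  by (simp add: cis_conv_exp)

lemma compact_arc: "compact (Defs.arc a b)"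
  unfolding arc_def
  by (intro compact_continuous_image continuous_intros) auto

text \<open>Preimages of closed sets under \<open>u\<close> are images under \<open>cis\<close> of
  compact sets of parameters, hence closed. This also covers the full circle, where
  \<open>cis\<close> identifies the ends.\<close>

lemma Ck_continuous_on_arc:
  assumes "u \<in> Ck a b k"
  shows "continuous_on (Defs.arc a b) u"
proof -
  have cont: "continuous_on {a..b} (\<lambda>t. u (cis t))"
    using assms unfolding Ck_def by (force simp: zero_enat_def[symmetric] dest: spec[of _ 0])
  have "closed (u -` B \<inter> Defs.arc a b)" if B: "closed B" for B
  proof -
    have "u -` B \<inter> Defs.arc a b = cis ` ((\<lambda>t. u (cis t)) -` B \<inter> {a..b})"
      by (auto simp: arc_def)
    moreover have "closed ((\<lambda>t. u (cis t)) -` B \<inter> {a..b})"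
      using cont B by (simp add: continuous_on_closed_vimage)
    then have "compact ((\<lambda>t. u (cis t)) -` B \<inter> {a..b})"
      by (metis Int_lower2 bounded_closed_interval bounded_subset compact_eq_bounded_closed)
    then have "compact (cis ` ((\<lambda>t. u (cis t)) -` B \<inter> {a..b}))"
      by (intro compact_continuous_image continuous_intros)
    ultimately show ?thesis by (simp add: compact_imp_closed)
  qed
  then show ?thesis
    by (simp add: continuous_on_closed_vimage compact_imp_closed compact_arc)
qed

text \<open>Passes from an arbitrary point of the arc, possibly an end, to a disc from a countable
  family whose real diameter is mapped into the arc.\<close>

lemma dyadic_disc_near:
  assumes "a < b" "z0 \<in> Defs.arc a b" "0 < r"
  obtains q n where "q \<in> dyadic_angles" "a < q" "q < b"
    "\<And>w. w \<in> cball (of_real q) (1 / Suc n) \<Longrightarrow> exp (\<i> * w) \<in> ball z0 r"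
    "\<And>x. \<bar>x - q\<bar> \<le> 1 / Suc n \<Longrightarrow> cis x \<in> Defs.arc a b"
proof -
  obtain t where t: "t \<in> {a..b}" "z0 = cis t" using assms(2) by (auto simp: arc_def)
  have "continuous (at (of_real t)) (\<lambda>w::complex. exp (\<i> * w))"
    by (intro continuous_intros)
  then obtain d where d: "0 < d" "\<And>w. dist w (of_real t) < d \<Longrightarrow> dist (exp (\<i> * w)) z0 < r"
    unfolding continuous_at_eps_delta using \<open>0 < r\<close> t(2) exp_i_of_real by metis
  have "max a (t - d) < min b (t + d)" using t d(1) \<open>a < b\<close> by auto
  then obtain q where q: "q \<in> dyadic_angles" "max a (t - d) < q" "q < min b (t + d)"
    by (rule dyadic_angles_dense)
  \<comment> \<open>The margin around \<open>q\<close> before a disc leaves the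
    \<open>d\<close>-disc about \<open>t\<close> or its diameter leaves the parameter
    interval.\<close>
  define m where "m = min (d - \<bar>q - t\<bar>) (min (q - a) (b - q))"
  have "0 < m" using q by (auto simp: m_def abs_if)
  then obtain n where n: "1 / Suc n < m"
    by (metis nat_approx_posE of_nat_Suc)
  show thesis
  proof (rule that[OF q(1)])
    show "a < q" "q < b" using q by auto
    show "exp (\<i> * w) \<in> ball z0 r" if "w \<in> cball (of_real q) (1 / Suc n)" for w
    proof -
      have "dist w (of_real t) \<le> dist (of_real q) w + dist (complex_of_real q) (of_real t)"
        by (metis dist_commute dist_triangle)
      also have "\<dots> < d" using that n by (simp add: dist_real_def m_def)
      finally show ?thesis using d(2) by (simp add: dist_commute)
    qed
    show "cis x \<in> Defs.arc a b" if "\<bar>x - q\<bar> \<le> 1 / Suc n" for x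
    proof -
      have "x \<in> {a..b}" using that n by (simp add: m_def abs_le_iff)
      then show ?thesis by (auto simp: arc_def)
    qed
  qed
qed

section \<open>Transfer of extensions between the circle and half discs\<close>

text \<open>Composing the given extension with \<open>exp (\<i> * w)\<close> near a dyadic angle
  gives a half-disc extension.\<close>

lemma side_ext_of_not_U_side:
  assumes "a < b" and s: "s = 1 \<or> s = -1" and G: "G = (\<lambda>z0 r. ball z0 r \<inter> {z. s * norm z < s})"
    and "u \<in> Ck a b k" "z0 \<in> Defs.arc a b" "u \<notin> U_side G a b z0 k"
  obtains q n L where "q \<in> dyadic_angles" "a < q" "q < b" "side_ext s q (1 / Suc n) (\<lambda>x. u (cis x)) L"
proof -
  obtain r lam where r: "r > 0" and lam: "continuous_on (Defs.arc a b \<union> G z0 r) lam"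
      "lam holomorphic_on G z0 r" "\<forall>z\<in>ball z0 r \<inter> Defs.arc a b. lam z = u z"
    using assms(4,6) unfolding U_side_def by auto
  obtain q n where q: "q \<in> dyadic_angles" "a < q" "q < b"
    and n: "\<And>w. w \<in> cball (of_real q) (1 / Suc n) \<Longrightarrow> exp (\<i> * w) \<in> ball z0 r"
    "\<And>x. \<bar>x - q\<bar> \<le> 1 / Suc n \<Longrightarrow> cis x \<in> Defs.arc a b"
    using dyadic_disc_near[OF assms(1,5) r] by blast
  let ?K = "half_disc s q (1 / Suc n)" and ?O = "open_half_disc s q (1 / Suc n)"
  have O: "(\<lambda>w. exp (\<i> * w)) ` ?O \<subseteq> G z0 r"
    using n(1) norm_exp_i_side[OF s] unfolding open_half_disc_def G by fastforce
  \<comment> \<open>Points of the closed half disc outside the preimage of \<open>G\<close> are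
    real, and the diameter is mapped into the arc.\<close>
  have K: "(\<lambda>w. exp (\<i> * w)) ` ?K \<subseteq> Defs.arc a b \<union> G z0 r"
  proof clarify
    fix w assume w: "w \<in> ?K" "exp (\<i> * w) \<notin> G z0 r"
    then have "s * Im w = 0"
      using n(1)[of w] norm_exp_i_side[OF s, of w] unfolding half_disc_def G by auto
    then have "w = of_real (Re w)" using s by (auto simp: complex_eq_iff)
    moreover have "\<bar>Re w - q\<bar> \<le> 1 / Suc n"
      using w(1) abs_Re_le_cmod[of "w - of_real q"] by (simp add: half_disc_def dist_norm norm_minus_commute)
    ultimately show "exp (\<i> * w) \<in> Defs.arc a b" using n(2) exp_i_of_real by metis
  qed
  have "side_ext s q (1 / Suc n) (\<lambda>x. u (cis x)) (lam \<circ> (\<lambda>w. exp (\<i> * w)))"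
    unfolding side_ext_def
  proof (intro conjI allI impI)
    show "continuous_on ?K (lam \<circ> (\<lambda>w. exp (\<i> * w)))"
      by (intro continuous_on_compose continuous_intros continuous_on_subset[OF lam(1) K])
    show "(lam \<circ> (\<lambda>w. exp (\<i> * w))) holomorphic_on ?O"
      by (intro holomorphic_on_compose holomorphic_intros holomorphic_on_subset[OF lam(2) O])
    fix x assume x: "\<bar>x - q\<bar> \<le> 1 / Suc n"
    then have "cis x \<in> ball z0 r"
      using n(1)[of "of_real x"] by (simp add: exp_i_of_real dist_real_def abs_minus_commute)
    then show "(lam \<circ> (\<lambda>w. exp (\<i> * w))) (of_real x) = u (cis x)"
      using n(2)[OF x] lam(3) by (simp add: exp_i_of_real)
  qed
  then show thesis using that q by blast
qed

text \<open>The pullback is holomorphic near the whole disc, so a single \<open>L\<close> serves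
  both signs.\<close>

lemma side_ext_of_not_U5:
  assumes "a < b" and "u \<in> Ck a b k" "z0 \<in> Defs.arc a b" "u \<notin> U5_at a b z0 k"
  obtains q n L where "q \<in> dyadic_angles" "a < q" "q < b"
    "\<And>s. side_ext s q (1 / Suc n) (\<lambda>x. u (cis x)) L"
proof -
  obtain r F where r: "r > 0" and F: "F holomorphic_on ball z0 r" "\<forall>z\<in>ball z0 r \<inter> Defs.arc a b. F z = u z"
    using assms(2,4) unfolding U5_at_def by auto
  obtain q n where q: "q \<in> dyadic_angles" "a < q" "q < b"
    and n: "\<And>w. w \<in> cball (of_real q) (1 / Suc n) \<Longrightarrow> exp (\<i> * w) \<in> ball z0 r"
    "\<And>x. \<bar>x - q\<bar> \<le> 1 / Suc n \<Longrightarrow> cis x \<in> Defs.arc a b"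
    using dyadic_disc_near[OF assms(1,3) r] by blast
  have hol: "(F \<circ> (\<lambda>w. exp (\<i> * w))) holomorphic_on A" if "A \<subseteq> cball (of_real q) (1 / Suc n)" for A
    using n(1) that by (intro holomorphic_on_compose holomorphic_intros holomorphic_on_subset[OF F(1)]) blast
  have "side_ext s q (1 / Suc n) (\<lambda>x. u (cis x)) (F \<circ> (\<lambda>w. exp (\<i> * w)))" for s
    unfolding side_ext_def
  proof (intro conjI allI impI)
    show "continuous_on (half_disc s q (1 / Suc n)) (F \<circ> (\<lambda>w. exp (\<i> * w)))"
      by (intro holomorphic_on_imp_continuous_on hol) (auto simp: half_disc_def)
    show "(F \<circ> (\<lambda>w. exp (\<i> * w))) holomorphic_on open_half_disc s q (1 / Suc n)"
      by (intro hol) (auto simp: open_half_disc_def)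
    fix x assume x: "\<bar>x - q\<bar> \<le> 1 / Suc n"
    then have "cis x \<in> ball z0 r"
      using n(1)[of "of_real x"] by (simp add: exp_i_of_real dist_real_def abs_minus_commute)
    then show "(F \<circ> (\<lambda>w. exp (\<i> * w))) (of_real x) = u (cis x)"
      using n(2)[OF x] F(2) by (simp add: exp_i_of_real)
  qed
  then show thesis using that q by blast
qed

text \<open>\<open>W\<close> is the branch of -i log z with value \<open>q\<close> at
  \<open>cis q\<close>; dividing by \<open>cis q\<close> moves the centre to 1, away from the cut of
  \<open>Ln\<close>.\<close>

lemma local_log:
  fixes q r :: real
  assumes "0 < r"
  obtains W d where "0 < d" "W holomorphic_on ball (cis q) d"
    "\<And>z. z \<in> ball (cis q) d \<Longrightarrow> exp (\<i> * W z) = z"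
    "\<And>z. z \<in> ball (cis q) d \<Longrightarrow> W z \<in> ball (of_real q) r"
proof -
  define W where "W z = of_real q - \<i> * Ln (z / cis q)" for z
  have n0: "z / cis q \<notin> \<real>\<^sub>\<le>\<^sub>0" if "z \<in> ball (cis q) 1" for z
  proof -
    have "norm (1 - z / cis q) = norm (cis q - z)"
      by (metis diff_divide_distrib div_by_1 divide_self cis_neq_zero norm_cis norm_divide)
    then have "norm (1 - z / cis q) < 1" using that by (simp add: dist_norm)
    then have "0 < Re (z / cis q)"
      using abs_Re_le_cmod[of "1 - z / cis q"] by (simp add: abs_if split: if_splits)
    then show ?thesis by (auto simp: complex_nonpos_Reals_iff)
  qed
  have hol: "W holomorphic_on ball (cis q) 1"
    unfolding W_def using n0 by (intro holomorphic_intros) auto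
  have "continuous (at (cis q)) W"
    using holomorphic_on_imp_continuous_on[OF hol] by (simp add: continuous_on_eq_continuous_at)
  moreover have "W (cis q) = of_real q" by (simp add: W_def)
  ultimately obtain d where d: "0 < d" "\<And>z. dist z (cis q) < d \<Longrightarrow> dist (W z) (of_real q) < r"
    unfolding continuous_at_eps_delta using assms by metis
  show thesis
  proof (rule that)
    show "0 < min d 1" using d(1) by simp
    show "W holomorphic_on ball (cis q) (min d 1)"
      by (rule holomorphic_on_subset[OF hol]) auto
    show "W z \<in> ball (of_real q) r" if "z \<in> ball (cis q) (min d 1)" for z
      using d(2)[of z] that by (simp add: dist_commute)
    show "exp (\<i> * W z) = z" if "z \<in> ball (cis q) (min d 1)" for z
    proof -
      have "z / cis q \<noteq> 0" using n0[of z] that by auto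
      moreover have "\<i> * W z = \<i> * of_real q + Ln (z / cis q)" by (simp add: W_def algebra_simps)
      ultimately show ?thesis by (simp add: exp_add exp_i_of_real)
    qed
  qed
qed

text \<open>Modulus 1 forces \<open>Im w = 0\<close>. The real parameter found is the one near
  \<open>q\<close>; its image \<open>cis x\<close> is what enters the later arguments.\<close>

lemma unit_circle_log_real:
  assumes "exp (\<i> * w) = z" "norm z = 1" "w \<in> ball (of_real q) r"
  obtains x where "w = of_real x" "\<bar>x - q\<bar> \<le> r" "cis x = z"
proof -
  have "exp (- Im w) = 1" using assms(1,2) by auto
  then have w: "w = of_real (Re w)" by (simp add: complex_eq_iff)
  moreover have "\<bar>Re w - q\<bar> \<le> r"
    using assms(3) abs_Re_le_cmod[of "w - of_real q"] by (simp add: dist_norm norm_minus_commute)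
  moreover have "cis (Re w) = z" using assms(1) w exp_i_of_real by metis
  ultimately show thesis using that by blast
qed

lemma norm_arc: "z \<in> Defs.arc a b \<Longrightarrow> norm z = 1"
  by (auto simp: arc_def)

text \<open>Continuity is local: intersecting with an open neighbourhood of a point does not change
  the filter there.\<close>

lemma continuous_on_open_cover:
  fixes f :: "'a::t2_space \<Rightarrow> 'b::topological_space"
  assumes "open A" "open B" "S \<subseteq> A \<union> B" "continuous_on (S \<inter> A) f" "continuous_on (S \<inter> B) f"
  shows "continuous_on S f"
proof -
  have *: "continuous (at x within S) f" if "x \<in> S" "x \<in> T" "open T" "continuous_on (S \<inter> T) f" for x T
  proof -
    have "at x within S \<inter> T = at x within S"
      by (rule at_within_nhd[OF that(2,3)]) auto
    then show ?thesis using that by (metis IntI continuous_on_eq_continuous_within)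
  qed
  show ?thesis
    unfolding continuous_on_eq_continuous_within
  proof
    fix x assume "x \<in> S"
    then show "continuous (at x within S) f"
      using *[OF _ _ assms(1,4)] *[OF _ _ assms(2,5)] assms(3) by blast
  qed
qed

text \<open>The local logarithm carries the half-disc extension to a one-sided neighbourhood of
  \<open>cis q\<close>; along the rest of the arc it is continued by \<open>u\<close>
  itself.\<close>

lemma not_U_side_of_side_ext:
  assumes s: "s = 1 \<or> s = -1" and G: "G = (\<lambda>z0 r. ball z0 r \<inter> {z. s * norm z < s})"
    and u: "u \<in> Ck a b k" and r: "0 < r" and L: "side_ext s q r (\<lambda>x. u (cis x)) L"
  shows "u \<notin> U_side G a b (cis q) k"
proof -
  obtain W d where d: "0 < d" and W: "W holomorphic_on ball (cis q) d"
    "\<And>z. z \<in> ball (cis q) d \<Longrightarrow> exp (\<i> * W z) = z"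
    "\<And>z. z \<in> ball (cis q) d \<Longrightarrow> W z \<in> ball (of_real q) r"
    by (rule local_log[OF r, of q]) (rule that)
  \<comment> \<open>Halving \<open>d\<close> creates an overlap: the open ball of radius
    \<open>d\<close> and the complement of the closed ball of radius \<open>d / 2\<close> form an
    open cover, and in the latter only arc points of \<open>?S\<close> remain.\<close>
  let ?B = "ball (cis q) d" and ?S = "Defs.arc a b \<union> G (cis q) (d / 2)"
  define lam where "lam z = (if z \<in> ?B then L (W z) else u z)" for z
  \<comment> \<open>On the arc inside the ball both formulas for \<open>lam\<close> agree, because
    \<open>W\<close> is real there.\<close>
  have arc: "L (W z) = u z" "Im (W z) = 0" if z: "z \<in> ?B" "z \<in> Defs.arc a b" for z
  proof -
    obtain x where "W z = of_real x" "\<bar>x - q\<bar> \<le> r" "cis x = z"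
      using unit_circle_log_real[OF W(2)[OF z(1)] norm_arc[OF z(2)] W(3)[OF z(1)]] by blast
    then show "L (W z) = u z" "Im (W z) = 0" using L by (auto simp: side_ext_def)
  qed
  have GO: "W z \<in> open_half_disc s q r" if "z \<in> ?B" "z \<in> G (cis q) d'" for z d'
    using norm_exp_i_side[OF s, of "W z"] W(2,3)[OF that(1)] that(2) by (simp add: open_half_disc_def G)
  have K: "W z \<in> half_disc s q r" if "z \<in> ?B" "z \<in> ?S" for z
  proof (cases "z \<in> Defs.arc a b")
    case True
    then show ?thesis using arc(2)[OF that(1)] W(3)[OF that(1)] by (auto simp: half_disc_def)
  next
    case False
    then show ?thesis using GO[OF that(1)] that(2) open_half_disc_subset by blast
  qed
  have sub: "G (cis q) (d / 2) \<subseteq> ?B" using d by (auto simp: G)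
  have lam_arc: "lam z = u z" if "z \<in> Defs.arc a b" for z
    using that arc(1) by (simp add: lam_def)
  have "continuous_on (?S \<inter> ?B) (\<lambda>z. L (W z))"
  proof (rule continuous_on_compose2[of "half_disc s q r" L _ W])
    show "continuous_on (half_disc s q r) L" using L by (simp add: side_ext_def)
    show "continuous_on (?S \<inter> ?B) W"
      by (rule continuous_on_subset[OF holomorphic_on_imp_continuous_on[OF W(1)]]) auto
    show "W ` (?S \<inter> ?B) \<subseteq> half_disc s q r" using K by blast
  qed
  then have c1: "continuous_on (?S \<inter> ?B) lam"
    by (subst continuous_on_cong[OF refl]) (auto simp: lam_def)
  have "?S - cball (cis q) (d / 2) \<subseteq> Defs.arc a b" by (auto simp: G)
  then have c2: "continuous_on (?S - cball (cis q) (d / 2)) lam"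
    using continuous_on_subset[OF Ck_continuous_on_arc[OF u]] lam_arc
    by (subst continuous_on_cong[OF refl, of _ _ u]) auto
  have "continuous_on ?S lam"
    by (rule continuous_on_open_cover[OF open_ball[of "cis q" d] open_Compl[OF closed_cball[of "cis q" "d / 2"]]])
      (use c1 c2 d in \<open>auto simp: Diff_eq\<close>)
  moreover have "lam holomorphic_on G (cis q) (d / 2)"
  proof -
    have img: "W ` G (cis q) (d / 2) \<subseteq> open_half_disc s q r" using GO sub by blast
    have "L holomorphic_on open_half_disc s q r" using L by (simp add: side_ext_def)
    then have "L \<circ> W holomorphic_on G (cis q) (d / 2)"
      using img holomorphic_on_compose holomorphic_on_subset[OF W(1) sub] holomorphic_on_subset by blast
    then show ?thesis
      by (rule holomorphic_transform) (use sub in \<open>auto simp: lam_def\<close>)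
  qed
  ultimately have "\<exists>r>0. \<exists>lam. continuous_on (Defs.arc a b \<union> G (cis q) r) lam \<and> lam holomorphic_on G (cis q) r
      \<and> (\<forall>z\<in>ball (cis q) r \<inter> Defs.arc a b. lam z = u z)"
    using d lam_arc by (intro exI[of _ "d / 2"] exI[of _ lam]) auto
  then show ?thesis unfolding U_side_def by blast
qed

text \<open>Paste the two extensions across the diameter and return to the circle by the local
  logarithm.\<close>

lemma not_U5_of_side_ext:
  assumes r: "0 < r" and L: "side_ext 1 q r (\<lambda>x. u (cis x)) L1" "side_ext (-1) q r (\<lambda>x. u (cis x)) L2"
  shows "u \<notin> U5_at a b (cis q) k"
proof -
  obtain F where F: "F holomorphic_on ball (of_real q) r" "\<And>x. \<bar>x - q\<bar> \<le> r \<Longrightarrow> F (of_real x) = u (cis x)"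
    using side_ext_paste[OF L] by blast
  obtain W d where d: "0 < d" and W: "W holomorphic_on ball (cis q) d"
    "\<And>z. z \<in> ball (cis q) d \<Longrightarrow> exp (\<i> * W z) = z"
    "\<And>z. z \<in> ball (cis q) d \<Longrightarrow> W z \<in> ball (of_real q) r"
    by (rule local_log[OF r, of q]) (rule that)
  have "F \<circ> W holomorphic_on ball (cis q) d"
    using W(3) by (intro holomorphic_on_compose W(1) holomorphic_on_subset[OF F(1)]) blast
  moreover have "(F \<circ> W) z = u z" if z: "z \<in> ball (cis q) d \<inter> Defs.arc a b" for z
  proof -
    have "z \<in> ball (cis q) d" "norm z = 1" using z norm_arc by auto
    then obtain x where "W z = of_real x" "\<bar>x - q\<bar> \<le> r" "cis x = z"
      using unit_circle_log_real W(2,3) by metis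
    then show ?thesis using F(2) by auto
  qed
  ultimately show ?thesis unfolding U5_at_def using d by blast
qed

section \<open>The complements of the classes as countable unions of closed sets\<close>

definition ext_set :: "real \<Rightarrow> real \<Rightarrow> enat \<Rightarrow> real \<Rightarrow> real \<Rightarrow> nat \<Rightarrow> (complex \<Rightarrow> complex) set" where
  "ext_set a b k s q n = {u \<in> Ck a b k. \<exists>L. side_ext s q (1 / Suc n) (\<lambda>x. u (cis x)) L}"

text \<open>The bound \<open>Suc M\<close> is always positive, as the limit argument
  requires.\<close>

definition bounded_ext_set :: "real \<Rightarrow> real \<Rightarrow> enat \<Rightarrow> real \<Rightarrow> real \<Rightarrow> nat \<Rightarrow> nat \<Rightarrow> (complex \<Rightarrow> complex) set" where
  "bounded_ext_set a b k s q n M = {u \<in> Ck a b k. \<exists>L. side_ext s q (1 / Suc n) (\<lambda>x. u (cis x)) L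
     \<and> (\<forall>w\<in>half_disc s q (1 / Suc n). norm (L w) \<le> Suc M)}"

text \<open>\<open>S\<close> lists the sides to which \<open>u\<close> extends with a common centre
  and radius: \<open>{-1}\<close> for the exterior, \<open>{1}\<close> for the interior,
  \<open>{1, -1}\<close> for extensions across the arc.\<close>

definition bad_set :: "real \<Rightarrow> real \<Rightarrow> enat \<Rightarrow> real set \<Rightarrow> (complex \<Rightarrow> complex) set" where
  "bad_set a b k S = (\<Union>q\<in>dyadic_angles \<inter> {a<..<b}. \<Union>n. \<Inter>s\<in>S. ext_set a b k s q n)"

lemma bad_setI:
  assumes "q \<in> dyadic_angles" "a < q" "q < b" "\<And>s. s \<in> S \<Longrightarrow> u \<in> ext_set a b k s q n"
  shows "u \<in> bad_set a b k S"
  unfolding bad_set_def using assms by (intro UN_I[of q] UN_I[of n]) auto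

lemma bad_setE:
  assumes "u \<in> bad_set a b k S"
  obtains q n where "q \<in> dyadic_angles" "a < q" "q < b" "\<And>s. s \<in> S \<Longrightarrow> u \<in> ext_set a b k s q n"
  using assms unfolding bad_set_def by (elim UN_E) (auto intro: that)

lemma bounded_ext_set_mono: "M \<le> M' \<Longrightarrow> bounded_ext_set a b k s q n M \<subseteq> bounded_ext_set a b k s q n M'"
  unfolding bounded_ext_set_def by fastforce

lemma ext_set_bounded:
  assumes "u \<in> ext_set a b k s q n"
  obtains M where "u \<in> bounded_ext_set a b k s q n M"
proof -
  obtain L where u: "u \<in> Ck a b k" and L: "side_ext s q (1 / Suc n) (\<lambda>x. u (cis x)) L"
    using assms by (auto simp: ext_set_def)
  have "bounded (L ` half_disc s q (1 / Suc n))"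
    using L compact_half_disc by (intro compact_imp_bounded compact_continuous_image) (auto simp: side_ext_def)
  then obtain B where B: "\<forall>w\<in>half_disc s q (1 / Suc n). norm (L w) \<le> B"
    unfolding bounded_iff by blast
  obtain M :: nat where "B \<le> M" using real_arch_simple by blast
  then have "\<forall>w\<in>half_disc s q (1 / Suc n). norm (L w) \<le> Suc M" using B by force
  then show thesis using that u L unfolding bounded_ext_set_def by blast
qed

text \<open>Closure points are uniform limits of functions with extensions bounded by
  \<open>Suc M\<close>, so they extend to a quarter of the radius; the new index comes from 4 (n +
  1) = (4 n + 3) + 1.\<close>

lemma closure_bounded_ext_set:
  assumes "a < b" and s: "s = 1 \<or> s = -1"
    and u: "u \<in> CkTop a b k closure_of bounded_ext_set a b k s q n M"
  shows "u \<in> ext_set a b k s q (4 * n + 3)"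
proof -
  have "\<exists>L. side_ext s q ((1 / Suc n) / 4) (\<lambda>x. u (cis x)) L"
  proof (rule side_ext_limit[OF s])
    fix e :: real assume "0 < e"
    then obtain v where v: "v \<in> bounded_ext_set a b k s q n M" "\<And>z. norm (v z - u z) \<le> e"
      using Ck_closure_uniform_approx[OF \<open>a < b\<close> u] by blast
    then show "\<exists>v L. side_ext s q (1 / Suc n) v L \<and> (\<forall>w\<in>half_disc s q (1 / Suc n). norm (L w) \<le> Suc M)
        \<and> (\<forall>x. \<bar>x - q\<bar> \<le> 1 / Suc n \<longrightarrow> norm (v x - u (cis x)) \<le> e)"
      unfolding bounded_ext_set_def by (intro exI[of _ "\<lambda>x. v (cis x)"]) auto
  qed auto
  moreover have "(1 / real (Suc n)) / 4 = 1 / Suc (4 * n + 3)" by (simp add: field_simps)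
  moreover have "u \<in> Ck a b k"
    using u topspace_CkTop[OF \<open>a < b\<close>] by (metis in_closure_of)
  ultimately show ?thesis by (simp only: ext_set_def mem_Collect_eq simp_thms)
qed

lemma fsigma_bad_set:
  assumes "a < b" and S: "S \<subseteq> {1, -1}" "S \<noteq> {}"
  shows "fsigma_in (CkTop a b k) (bad_set a b k S)"
proof -
  let ?C = "\<lambda>s q n M. CkTop a b k closure_of bounded_ext_set a b k s q n M"
  let ?I = "(dyadic_angles \<inter> {a<..<b}) \<times> (UNIV :: (nat \<times> nat) set)"
  have fin: "finite S" using S(1) finite_subset by blast
  have "bad_set a b k S = \<Union>((\<lambda>(q, n, M). \<Inter>s\<in>S. ?C s q n M) ` ?I)" (is "_ = ?R")
  proof
    show "bad_set a b k S \<subseteq> ?R"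
    proof
      fix u assume "u \<in> bad_set a b k S"
      then obtain q n where q: "q \<in> dyadic_angles" "a < q" "q < b"
        and u: "\<And>s. s \<in> S \<Longrightarrow> u \<in> ext_set a b k s q n"
        using bad_setE by blast
      have "\<forall>s\<in>S. \<exists>M. u \<in> bounded_ext_set a b k s q n M"
        using u ext_set_bounded by metis
      then obtain M where M: "\<And>s. s \<in> S \<Longrightarrow> u \<in> bounded_ext_set a b k s q n (M s)" by metis
      \<comment> \<open>A maximum over the finite set \<open>S\<close> gives one bound for all
        sides, so that the index stays countable.\<close>
      have "u \<in> ?C s q n (Max (M ` S))" if "s \<in> S" for s
      proof -
        have "M s \<le> Max (M ` S)" using fin that by simp
        then have "u \<in> bounded_ext_set a b k s q n (Max (M ` S))"
          using M[OF that] bounded_ext_set_mono by blast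
        moreover have "bounded_ext_set a b k s q n (Max (M ` S)) \<subseteq> topspace (CkTop a b k)"
          by (auto simp: topspace_CkTop[OF \<open>a < b\<close>] bounded_ext_set_def)
        ultimately show ?thesis using closure_of_subset by blast
      qed
      then show "u \<in> ?R" using q by (intro UN_I[of "(q, n, Max (M ` S))"]) auto
    qed
    show "?R \<subseteq> bad_set a b k S"
    proof clarify
      fix u q n M assume q: "q \<in> dyadic_angles" "q \<in> {a<..<b}" and u: "u \<in> (\<Inter>s\<in>S. ?C s q n M)"
      have "u \<in> ext_set a b k s q (4 * n + 3)" if "s \<in> S" for s
        using closure_bounded_ext_set[OF \<open>a < b\<close>, of s u k q n M] u that S(1) by blast
      then show "u \<in> bad_set a b k S" using q by (intro bad_setI) auto
    qed
  qed
  moreover have "fsigma_in (CkTop a b k) ?R"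
  proof (rule fsigma_in_Union)
    show "countable ((\<lambda>(q, n, M). \<Inter>s\<in>S. ?C s q n M) ` ?I)"
      using countable_dyadic_angles by (intro countable_image countable_SIGMA countable_Int1) auto
    show "fsigma_in (CkTop a b k) T" if "T \<in> (\<lambda>(q, n, M). \<Inter>s\<in>S. ?C s q n M) ` ?I" for T
      using that S(2) by (auto intro!: closed_imp_fsigma_in closedin_Inter)
  qed
  ultimately show ?thesis by simp
qed

text \<open>Extendability at any point of the arc implies it at some dyadic angle inside the
  interval, and conversely such an angle gives a point of the arc.\<close>

lemma Ck_minus_bad_set_side:
  assumes "a < b" and s: "s = 1 \<or> s = -1" and G: "G = (\<lambda>z0 r. ball z0 r \<inter> {z. s * norm z < s})"
  shows "Ck a b k \<inter> (\<Inter>z0\<in>Defs.arc a b. U_side G a b z0 k) = Ck a b k - bad_set a b k {s}"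
proof -
  have "(\<exists>z0\<in>Defs.arc a b. u \<notin> U_side G a b z0 k) \<longleftrightarrow> u \<in> bad_set a b k {s}" if u: "u \<in> Ck a b k" for u
  proof
    assume "\<exists>z0\<in>Defs.arc a b. u \<notin> U_side G a b z0 k"
    then obtain q n L where "q \<in> dyadic_angles" "a < q" "q < b" "side_ext s q (1 / Suc n) (\<lambda>x. u (cis x)) L"
      using side_ext_of_not_U_side[OF assms u] by blast
    then show "u \<in> bad_set a b k {s}"
      using u by (intro bad_setI[of q _ _ _ _ _ n]) (auto simp: ext_set_def)
  next
    assume "u \<in> bad_set a b k {s}"
    then obtain q n where q: "a < q" "q < b" and "u \<in> ext_set a b k s q n"
      by (rule bad_setE) auto
    then obtain L where L: "side_ext s q (1 / Suc n) (\<lambda>x. u (cis x)) L"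
      unfolding ext_set_def by blast
    have "u \<notin> U_side G a b (cis q) k"
      by (rule not_U_side_of_side_ext[OF s G u _ L]) simp
    moreover have "cis q \<in> Defs.arc a b" using q by (auto simp: arc_def)
    ultimately show "\<exists>z0\<in>Defs.arc a b. u \<notin> U_side G a b z0 k" by blast
  qed
  then show ?thesis by blast
qed

lemma U2_eq: "a < b \<Longrightarrow> U2 a b k = Ck a b k - bad_set a b k {-1}"
  unfolding U2_def U2_at_def by (rule Ck_minus_bad_set_side[OF _ _ Omega_out_eq]) auto

lemma U3_eq: "a < b \<Longrightarrow> U3 a b k = Ck a b k - bad_set a b k {1}"
  unfolding U3_def U3_at_def by (rule Ck_minus_bad_set_side[OF _ _ P_in_eq]) auto

text \<open>Extending holomorphically across the arc amounts to extending to both sides about the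
  same dyadic angle, by pasting.\<close>

lemma U5_eq:
  assumes "a < b"
  shows "U5 a b k = Ck a b k - bad_set a b k {1, -1}"
proof -
  have "(\<exists>z0\<in>Defs.arc a b. u \<notin> U5_at a b z0 k) \<longleftrightarrow> u \<in> bad_set a b k {1, -1}" if u: "u \<in> Ck a b k" for u
  proof
    assume "\<exists>z0\<in>Defs.arc a b. u \<notin> U5_at a b z0 k"
    then obtain q n L where "q \<in> dyadic_angles" "a < q" "q < b"
      "\<And>s. side_ext s q (1 / Suc n) (\<lambda>x. u (cis x)) L"
      using side_ext_of_not_U5[OF assms u] by metis
    then show "u \<in> bad_set a b k {1, -1}"
      using u by (intro bad_setI[of q _ _ _ _ _ n]) (auto simp: ext_set_def)
  next
    assume "u \<in> bad_set a b k {1, -1}"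
    then obtain q n where q: "a < q" "q < b"
      and "u \<in> ext_set a b k 1 q n" "u \<in> ext_set a b k (-1) q n"
      by (rule bad_setE) auto
    then obtain L1 L2 where L: "side_ext 1 q (1 / Suc n) (\<lambda>x. u (cis x)) L1" "side_ext (-1) q (1 / Suc n) (\<lambda>x. u (cis x)) L2"
      unfolding ext_set_def by blast
    have "u \<notin> U5_at a b (cis q) k"
      by (rule not_U5_of_side_ext[OF _ L]) simp
    moreover have "cis q \<in> Defs.arc a b" using q by (auto simp: arc_def)
    ultimately show "\<exists>z0\<in>Defs.arc a b. u \<notin> U5_at a b z0 k" by blast
  qed
  then show ?thesis unfolding U5_def by blast
qed

lemma U4_eq: "U4 a b k = U2 a b k \<inter> U3 a b k"
  unfolding U2_def U3_def U4_def U4_at_def by blast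

section \<open>Nowhere extendable functions and the conclusion\<close>

text \<open>From an extension to one side, cancel the entire part, reflect the real lacunary series
  to the other side and paste: the series would be analytic at a dyadic angle.\<close>

lemma entire_plus_lacunary_not_bad:
  assumes v: "v \<in> entire_plus_lacunary a b" and S: "S \<subseteq> {1, -1}" "S \<noteq> {}"
  shows "v \<notin> bad_set a b k S"
proof
  assume "v \<in> bad_set a b k S"
  then obtain q n where q: "q \<in> dyadic_angles" "a < q" "q < b"
    and ext: "\<And>s. s \<in> S \<Longrightarrow> v \<in> ext_set a b k s q n"
    by (rule bad_setE) auto
  obtain s where "s \<in> S" using S(2) by blast
  then have s: "s = 1 \<or> s = -1" using S(1) by blast
  obtain L where L: "side_ext s q (1 / Suc n) (\<lambda>x. v (cis x)) L"
    using ext[OF \<open>s \<in> S\<close>] unfolding ext_set_def by blast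
  obtain P d where P: "P holomorphic_on UNIV" "d \<noteq> 0"
    and vP: "\<And>t. t \<in> {a..b} \<Longrightarrow> v (cis t) = P (of_real t) + d * of_real (lacunary 0 t)"
    using v unfolding entire_plus_lacunary_def by blast
  \<comment> \<open>The radius is shrunk so that the diameter lies in \<open>{a..b}\<close>, where
    the formula for \<open>v\<close> holds.\<close>
  define r where "r = min (1 / Suc n) (min (q - a) (b - q))"
  have r: "0 < r" "r \<le> 1 / Suc n" using q by (auto simp: r_def)
  have "x \<in> {a..b}" if "\<bar>x - q\<bar> \<le> r" for x using that by (auto simp: r_def abs_le_iff)
  then have "side_ext s q r (\<lambda>x. P (of_real x) + d * of_real (lacunary 0 x)) L"
    using side_ext_mono[OF L r(2)] vP unfolding side_ext_def by metis
  from side_ext_cancel_entire[OF this P] obtain L' where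
    L': "side_ext s q r (\<lambda>x. of_real (lacunary 0 x)) L'" by blast
  then have L'': "side_ext (- s) q r (\<lambda>x. of_real (lacunary 0 x)) (cnj \<circ> L' \<circ> cnj)"
    by (rule side_ext_cnj) simp
  obtain L1 L2 where "side_ext 1 q r (\<lambda>x. of_real (lacunary 0 x)) L1"
    "side_ext (-1) q r (\<lambda>x. of_real (lacunary 0 x)) L2"
    using s L' L'' by (metis minus_minus)
  then obtain F where "F holomorphic_on ball (of_real q) r"
    "\<And>x. \<bar>x - q\<bar> \<le> r \<Longrightarrow> F (of_real x) = of_real (lacunary 0 x)"
    using side_ext_paste by blast
  then show False using lacunary_not_analytic[OF q(1) r(1), of F] by simp
qed

theorem theorem4p7:
  fixes a b :: real and k :: enat
  assumes "0 \<le> a" "a < b" "b \<le> 2 * pi"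
  shows "dense_gdelta_in (CkTop a b k) (U2 a b k)
       \<and> dense_gdelta_in (CkTop a b k) (U3 a b k)
       \<and> dense_gdelta_in (CkTop a b k) (U4 a b k)
       \<and> dense_gdelta_in (CkTop a b k) (U5 a b k)"
proof -
  let ?X = "CkTop a b k" and ?D = "Ck a b k \<inter> entire_plus_lacunary a b"
  have gd: "gdelta_in ?X (Ck a b k - bad_set a b k S)" if "S \<subseteq> {1, -1}" "S \<noteq> {}" for S
    using gdelta_in_diff[OF gdelta_in_topspace fsigma_bad_set[OF assms(2) that]] topspace_CkTop[OF assms(2)] by metis
  have D: "?D \<subseteq> Ck a b k - bad_set a b k S" if "S \<subseteq> {1, -1}" "S \<noteq> {}" for S
    using entire_plus_lacunary_not_bad[OF _ that] by blast
  have "?X closure_of ?D = topspace ?X"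
    by (rule CkTop_denseI[OF assms(2)]) (use entire_plus_lacunary_approx[OF assms] in auto)
  \<comment> \<open>The dense set \<open>?D\<close> lies in all four classes, so monotonicity of
    closure gives every density claim, including that of the intersection class
    \<open>U4\<close>.\<close>
  then have dense: "?X closure_of T = topspace ?X" if "?D \<subseteq> T" for T
    using closure_of_mono[OF that, of ?X] closure_of_subset_topspace[of ?X T] by blast
  show ?thesis
    unfolding dense_gdelta_in_def U4_eq U2_eq[OF assms(2)] U3_eq[OF assms(2)] U5_eq[OF assms(2)]
    by (intro conjI gdelta_in_Int gd dense Int_greatest D) auto
qed

end
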